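(* Every Artin--Tits presentation $(S,R)$ of spherical type satisfies Property H: for every word $w$ of $\mathcal W(S)$ that represents $1$ in the group $\langle S\mid R\rangle$, the relation $w\rightsquigarrow^{0,1,2}_R\varepsilon$ holds.
   Context: For a set $S$, $\mathcal W^+(S)$ is the free monoid of all words in the alphabet $S$, and $\mathcal W(S)$ is the free monoid of all words in $S\sqcup S^{-1}$, where $S^{-1}$ is a disjoint copy of $S$ with one letter $s^{-1}$ for each $s\in S$. The empty word is $\varepsilon$; $w^{-1}$ is obtained from $w$ by exchanging $s$ and $s^{-1}$ everywhere and reversing the order of letters. A factor of a word is a contiguous subword. A presentation $(S,R)$ is positive if every relation of $R$ is of the form $v=v'$ with $v,v'$ nonempty words of $\mathcal W^+(S)$ (relations are unoriented). $\langle S\mid R\rangle$ is the group it presents. Special transformations on words of $\mathcal W(S)$: - type $0$: remove some pair $s^{-1}s$ or $ss^{-1}$ with $s\in S$; - type $1$: replace some factor $v$ by $v'$, or $v^{-1}$ by $v'^{-1}$, where $v=v'$ is a relation of $R$; - type $2_r$: replace some factor $v^{-1}v'$ by $uu'^{-1}$, where $v,v'$ are nonempty words of $\mathcal W^+(S)$ and $vu=v'u'$ is a relation of $R$; - type $2_\ell$: replace some factor $vv'^{-1}$ by $u^{-1}u'$, where $v,v'$ are nonempty words of $\mathcal W^+(S)$ and $uv=u'v'$ is a relation of $R$. Type $2$ means $2_r$ or $2_\ell$. One writes $w\rightsquigarrow^{0,1,2}_R w'$ if $w$ can be transformed to $w'$ by a finite (possibly empty) sequence of special transformations of types $0$, $1$,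 $2$. An Artin--Tits presentation is a presentation $(S,R)$ in which $R$ consists of relations $sts\cdots=tst\cdots$ with $s\ne t$ in $S$, both sides being alternating words in $s,t$ of the same length at least $2$, with at most one such relation for each pair $\{s,t\}$. It is of spherical type if the associated Coxeter group, i.e. the quotient of $\langle S\mid R\rangle$ obtained by adding the relations $s^2=1$ for all $s\in S$, is finite. *)

theory Defs
  imports "HOL-Algebra.Group"
begin

section \<open>Words and presented groups\<close>

datatype 'a letter = Pos 'a | Neg 'a

type_synonym 'a word = "'a letter list"

fun inv_letter :: "'a letter \<Rightarrow> 'a letter" where
  "inv_letter (Pos s) = Neg s"
| "inv_letter (Neg s) = Pos s"

definition inv_word :: "'a word \<Rightarrow> 'a word" where
  "inv_word w = rev (map inv_letter w)"

definition words :: "'a set \<Rightarrow> 'a word set" where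
  "words S = lists (Pos ` S \<union> Neg ` S)"

definition pos_words :: "'a set \<Rightarrow> 'a word set" where
  "pos_words S = lists (Pos ` S)"

text \<open>The congruence on \<open>words S\<close> generated by \<open>R\<close> and by free cancellation.\<close>

inductive_set pres_cong :: "'a set \<Rightarrow> ('a word \<times> 'a word) set \<Rightarrow> ('a word \<times> 'a word) set"
  for S :: "'a set" and R :: "('a word \<times> 'a word) set" where
  rel: "\<lbrakk>(v, v') \<in> R; x \<in> words S; y \<in> words S; v \<in> words S; v' \<in> words S\<rbrakk>
    \<Longrightarrow> (x @ v @ y, x @ v' @ y) \<in> pres_cong S R"
| cancel_right: "\<lbrakk>s \<in> S; x \<in> words S; y \<in> words S\<rbrakk>
    \<Longrightarrow> (x @ [Pos s, Neg s] @ y, x @ y) \<in> pres_cong S R"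
| cancel_left: "\<lbrakk>s \<in> S; x \<in> words S; y \<in> words S\<rbrakk>
    \<Longrightarrow> (x @ [Neg s, Pos s] @ y, x @ y) \<in> pres_cong S R"
| refl: "w \<in> words S \<Longrightarrow> (w, w) \<in> pres_cong S R"
| sym: "(v, w) \<in> pres_cong S R \<Longrightarrow> (w, v) \<in> pres_cong S R"
| trans: "\<lbrakk>(u, v) \<in> pres_cong S R; (v, w) \<in> pres_cong S R\<rbrakk> \<Longrightarrow> (u, w) \<in> pres_cong S R"

definition word_class :: "'a set \<Rightarrow> ('a word \<times> 'a word) set \<Rightarrow> 'a word \<Rightarrow> 'a word set" where
  "word_class S R w = pres_cong S R `` {w}"

definition presented_group :: "'a set \<Rightarrow> ('a word \<times> 'a word) set \<Rightarrow> 'a word set monoid" where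
  "presented_group S R =
    \<lparr>carrier = words S // pres_cong S R,
     mult = (\<lambda>X Y. \<Union>x\<in>X. \<Union>y\<in>Y. word_class S R (x @ y)),
     one = word_class S R []\<rparr>"

lemma words_append [simp]: "v @ w \<in> words S \<longleftrightarrow> v \<in> words S \<and> w \<in> words S"
  by (auto simp: words_def)

lemma words_Nil [simp]: "[] \<in> words S"
  by (auto simp: words_def)

lemma words_Cons [simp]:
  "Pos s # w \<in> words S \<longleftrightarrow> s \<in> S \<and> w \<in> words S"
  "Neg s # w \<in> words S \<longleftrightarrow> s \<in> S \<and> w \<in> words S"
  by (auto simp: words_def)

lemma pres_cong_words:
  assumes "(v, w) \<in> pres_cong S R"
  shows "v \<in> words S" and "w \<in> words S"
  using assms by (induction) auto

lemma equiv_pres_cong: "equiv (words S) (pres_cong S R)"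
proof (rule equivI)
  show "pres_cong S R \<subseteq> words S \<times> words S"
    using pres_cong_words by fast
  show "refl_on (words S) (pres_cong S R)"
    by (intro refl_onI pres_cong.refl)
  show "sym (pres_cong S R)"
    by (intro symI) (rule pres_cong.sym)
  show "trans (pres_cong S R)"
    by (intro transI) (rule pres_cong.trans)
qed

lemma pres_cong_context:
  assumes "(v, w) \<in> pres_cong S R" "x \<in> words S" "y \<in> words S"
  shows "(x @ v @ y, x @ w @ y) \<in> pres_cong S R"
  using assms(1)
proof induction
  case (rel v v' a b)
  then show ?case
    using pres_cong.rel[of v v' R "x @ a" S "b @ y"] assms(2,3) by simp
next
  case (cancel_right s a b)
  then show ?case
    using pres_cong.cancel_right[of s S "x @ a" "b @ y" R] assms(2,3) by simp
next
  case (cancel_left s a b)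
  then show ?case
    using pres_cong.cancel_left[of s S "x @ a" "b @ y" R] assms(2,3) by simp
next
  case (refl w)
  then have "x @ w @ y \<in> words S" using assms(2,3) by simp
  then show ?case by (rule pres_cong.refl)
next
  case (sym v w)
  from sym.IH show ?case by (rule pres_cong.sym)
next
  case (trans u v w)
  from trans.IH show ?case by (rule pres_cong.trans)
qed

lemma pres_cong_append:
  assumes "(v, v') \<in> pres_cong S R" "(w, w') \<in> pres_cong S R"
  shows "(v @ w, v' @ w') \<in> pres_cong S R"
proof (rule pres_cong.trans)
  show "(v @ w, v' @ w) \<in> pres_cong S R"
    using pres_cong_context[OF assms(1), of "[]" w] pres_cong_words[OF assms(2)] by simp
  show "(v' @ w, v' @ w') \<in> pres_cong S R"
    using pres_cong_context[OF assms(2), of v' "[]"] pres_cong_words[OF assms(1)] by simp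
qed

lemma word_class_eq_iff:
  "\<lbrakk>v \<in> words S; w \<in> words S\<rbrakk>
    \<Longrightarrow> word_class S R v = word_class S R w \<longleftrightarrow> (v, w) \<in> pres_cong S R"
  unfolding word_class_def by (rule eq_equiv_class_iff[OF equiv_pres_cong])

lemma carrier_presented_group:
  "carrier (presented_group S R) = word_class S R ` words S"
  by (auto simp: presented_group_def word_class_def quotient_def)

lemma one_presented_group: "\<one>\<^bsub>presented_group S R\<^esub> = word_class S R []"
  by (simp add: presented_group_def)

lemma mult_presented_group:
  assumes "v \<in> words S" "w \<in> words S"
  shows "word_class S R v \<otimes>\<^bsub>presented_group S R\<^esub> word_class S R w = word_class S R (v @ w)"
proof -
  have *: "word_class S R (x @ y) = word_class S R (v @ w)"
    if "x \<in> word_class S R v" "y \<in> word_class S R w" for x y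
  proof -
    have "(v, x) \<in> pres_cong S R" "(w, y) \<in> pres_cong S R"
      using that by (simp_all add: word_class_def)
    then have "(v @ w, x @ y) \<in> pres_cong S R"
      by (rule pres_cong_append)
    then show ?thesis
      unfolding word_class_def by (rule equiv_class_eq[OF equiv_pres_cong, symmetric])
  qed
  have ne: "word_class S R v \<noteq> {}" "word_class S R w \<noteq> {}"
    using assms pres_cong.refl by (auto simp: word_class_def)
  have "(\<Union>y\<in>word_class S R w. word_class S R (x @ y)) = word_class S R (v @ w)"
    if "x \<in> word_class S R v" for x
    using ne(2) *[OF that] by (rule SUP_eq_const)
  from SUP_eq_const[OF ne(1) this] show ?thesis
    by (simp add: presented_group_def)
qed

lemma inv_word_words [simp]: "inv_word w \<in> words S \<longleftrightarrow> w \<in> words S"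
proof (induction w)
  case (Cons a w)
  then show ?case by (cases a) (auto simp: inv_word_def)
qed (simp add: inv_word_def)

lemma inv_word_cancel: "w \<in> words S \<Longrightarrow> (inv_word w @ w, []) \<in> pres_cong S R"
proof (induction w)
  case Nil
  then show ?case by (auto simp: inv_word_def intro: pres_cong.refl)
next
  case (Cons a w)
  have w: "w \<in> words S" using Cons.prems by (cases a) auto
  have "(inv_word w @ [inv_letter a, a] @ w, inv_word w @ w) \<in> pres_cong S R"
    using Cons.prems w pres_cong.cancel_left[of _ S "inv_word w" w R]
      pres_cong.cancel_right[of _ S "inv_word w" w R]
    by (cases a) simp_all
  from pres_cong.trans[OF this Cons.IH[OF w]] show ?case
    by (simp add: inv_word_def)
qed

lemma group_presented_group: "group (presented_group S R)"
proof (rule groupI)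
  fix X assume "X \<in> carrier (presented_group S R)"
  then obtain w where w: "w \<in> words S" "X = word_class S R w"
    by (auto simp: carrier_presented_group)
  have "word_class S R (inv_word w @ w) = word_class S R []"
    using w inv_word_cancel[of w S R] by (subst word_class_eq_iff) auto
  then show "\<exists>Y\<in>carrier (presented_group S R). Y \<otimes>\<^bsub>presented_group S R\<^esub> X = \<one>\<^bsub>presented_group S R\<^esub>"
    using w by (intro bexI[of _ "word_class S R (inv_word w)"])
      (auto simp: carrier_presented_group mult_presented_group one_presented_group)
qed (auto simp: carrier_presented_group mult_presented_group one_presented_group)


section \<open>Special transformations\<close>

text \<open>Relations are unoriented, but stored as pairs: \<open>v = v'\<close> is a relation of \<open>R\<close> as soon as
  one of its two orientations belongs to \<open>R\<close>.\<close>

definition is_relation :: "('a word \<times> 'a word) set \<Rightarrow> 'a word \<Rightarrow> 'a word \<Rightarrow> bool" where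
  "is_relation R v v' \<longleftrightarrow> (v, v') \<in> R \<or> (v', v) \<in> R"

definition positive_presentation :: "'a set \<Rightarrow> ('a word \<times> 'a word) set \<Rightarrow> bool" where
  "positive_presentation S R \<longleftrightarrow> R \<subseteq> (pos_words S - {[]}) \<times> (pos_words S - {[]})"

text \<open>In the rules of type 2, the words \<open>u\<close> and \<open>u'\<close> may be empty; they are positive whenever
  the presentation is.\<close>

inductive special :: "'a set \<Rightarrow> ('a word \<times> 'a word) set \<Rightarrow> 'a word \<Rightarrow> 'a word \<Rightarrow> bool"
  for S :: "'a set" and R :: "('a word \<times> 'a word) set" where
  type0_left: "s \<in> S \<Longrightarrow> special S R (x @ [Neg s, Pos s] @ y) (x @ y)"
| type0_right: "s \<in> S \<Longrightarrow> special S R (x @ [Pos s, Neg s] @ y) (x @ y)"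
| type1_pos: "is_relation R v v' \<Longrightarrow> special S R (x @ v @ y) (x @ v' @ y)"
| type1_neg: "is_relation R v v' \<Longrightarrow> special S R (x @ inv_word v @ y) (x @ inv_word v' @ y)"
| type2_right: "\<lbrakk>v \<in> pos_words S; v' \<in> pos_words S; v \<noteq> []; v' \<noteq> []; is_relation R (v @ u) (v' @ u')\<rbrakk>
    \<Longrightarrow> special S R (x @ inv_word v @ v' @ y) (x @ u @ inv_word u' @ y)"
| type2_left: "\<lbrakk>v \<in> pos_words S; v' \<in> pos_words S; v \<noteq> []; v' \<noteq> []; is_relation R (u @ v) (u' @ v')\<rbrakk>
    \<Longrightarrow> special S R (x @ v @ inv_word v' @ y) (x @ inv_word u @ u' @ y)"

definition property_H :: "'a set \<Rightarrow> ('a word \<times> 'a word) set \<Rightarrow> bool" where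
  "property_H S R \<longleftrightarrow>
    (\<forall>w\<in>words S. word_class S R w = \<one>\<^bsub>presented_group S R\<^esub> \<longrightarrow> (special S R)\<^sup>*\<^sup>* w [])"


section \<open>Artin--Tits presentations\<close>

fun alternating :: "'a \<Rightarrow> 'a \<Rightarrow> nat \<Rightarrow> 'a word" where
  "alternating s t 0 = []"
| "alternating s t (Suc n) = Pos s # alternating t s n"

definition artin_tits_presentation :: "'a set \<Rightarrow> ('a word \<times> 'a word) set \<Rightarrow> bool" where
  "artin_tits_presentation S R \<longleftrightarrow>
    (\<forall>r\<in>R. \<exists>s\<in>S. \<exists>t\<in>S. \<exists>m\<ge>2. s \<noteq> t \<and> r = (alternating s t m, alternating t s m)) \<and>
    (\<forall>s\<in>S. \<forall>t\<in>S. \<forall>m n. s \<noteq> t \<longrightarrow>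
      is_relation R (alternating s t m) (alternating t s m) \<longrightarrow>
      is_relation R (alternating s t n) (alternating t s n) \<longrightarrow> m = n)"

definition coxeter_group :: "'a set \<Rightarrow> ('a word \<times> 'a word) set \<Rightarrow> 'a word set monoid" where
  "coxeter_group S R = presented_group S (R \<union> {([Pos s, Pos s], []) | s. s \<in> S})"

definition spherical_type :: "'a set \<Rightarrow> ('a word \<times> 'a word) set \<Rightarrow> bool" where
  "spherical_type S R \<longleftrightarrow> finite (carrier (coxeter_group S R))"

lemma alternating_pos_words: "\<lbrakk>s \<in> S; t \<in> S\<rbrakk> \<Longrightarrow> alternating s t m \<in> pos_words S"
  by (induction s t m rule: alternating.induct) (auto simp: pos_words_def)

lemma artin_tits_positive:
  assumes "artin_tits_presentation S R"
  shows "positive_presentation S R"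
  unfolding positive_presentation_def
proof
  fix r assume "r \<in> R"
  then obtain s t m where r: "s \<in> S" "t \<in> S" "m \<ge> 2"
    "r = (alternating s t m, alternating t s m)"
    using assms unfolding artin_tits_presentation_def by meson
  have "alternating s t m \<noteq> []" "alternating t s m \<noteq> []"
    using r(3) by (cases m; simp)+
  then show "r \<in> (pos_words S - {[]}) \<times> (pos_words S - {[]})"
    using r by (simp add: alternating_pos_words)
qed

end

theory Submission
  imports Defs Complex_Main
begin

text \<open>
  By means of transformations of types 0 and 2, every word is transformed into a fraction, a
  positive word \<open>p\<close> followed by the inverse of a positive word \<open>q\<close>. If the word represents the neutral
  element, then \<open>p\<close> and \<open>q\<close> are equal in the group. If moreover the Artin--Tits monoid embeds in the
  group, then \<open>p\<close> and \<open>q\<close> are connected by braid relations, so that type 1 turns \<open>p\<close> into \<open>q\<close>, and type 0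
  removes the remaining word.

  Both steps rest on the divisibility theory of the monoid: it is left cancellative
  (\<open>braid_cancel_left\<close>), and a common right multiple of two distinct generators is a right multiple
  of the common value of the two sides of their relation (\<open>braid_common_multiple\<close>). In the spherical case
  there is moreover a central element divisible by all the generators, the square of the Garside
  element (\<open>garside\<close>). Hence any two positive words have a common right multiple, which bounds the
  process of reversing (\<open>reversing\<close>), and every word is a fraction of a positive word by a power of the
  central element, from which the embedding follows (\<open>monoid_embeds\<close>).

  The divisibility theory holds for all Artin--Tits monoids and is derived from the Coxeter group.
  The exchange property comes from the parity of the number of occurrences of a reflection in a
  word; together with the geometric representation, which gives the exact order of a product of two
  generators, it yields the description of elements with two left descents (\<open>two_descents\<close>) and
  Matsumoto's theorem (\<open>matsumoto\<close>). For elements \<open>a\<close> and \<open>b\<close> of the Coxeter group, there is a greatest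
  prefix of \<open>b\<close> whose product with \<open>a\<close> is length-additive (\<open>head_greatest\<close>). Moving this prefix from \<open>b\<close> to
  \<open>a\<close>, and going on in the same way, makes the monoid act on sequences of elements of the Coxeter
  group (\<open>act_act\<close>). Acting on the trivial sequence gives a normal form, from which an element of
  the monoid and its left quotients by generators can be recovered.
\<close>

section \<open>Coxeter matrices and their two congruences\<close>

text \<open>The word \<open>s t s \<dots>\<close> with \<open>n\<close> letters. Positive words are lists of generators from here on;
  they are turned into words in signed letters only at the end.\<close>

fun alt :: "'a \<Rightarrow> 'a \<Rightarrow> nat \<Rightarrow> 'a list" where
  "alt s t 0 = []"
| "alt s t (Suc n) = s # alt t s n"

lemma length_alt [simp]: "length (alt s t n) = n"
  by (induction s t n rule: alt.induct) auto

lemma alt_add: "alt s t (n + k) = alt s t n @ (if even n then alt s t k else alt t s k)"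
  by (induction s t n rule: alt.induct) auto

lemma alt_snoc: "alt s t (Suc n) = alt s t n @ [if even n then s else t]"
  using alt_add[of s t n 1] by auto

lemma rev_alt: "rev (alt s t n) = (if even n then alt t s n else alt s t n)"
proof (induction s t n rule: alt.induct)
  case (2 s t n)
  have "rev (alt s t (Suc n)) = rev (alt t s n) @ [s]" by simp
  also have "\<dots> = (if even (Suc n) then alt t s (Suc n) else alt s t (Suc n))"
    using 2 alt_snoc[of s t n] alt_snoc[of t s n] by auto
  finally show ?case .
qed simp

lemma set_alt: "set (alt s t n) \<subseteq> {s, t}"
  by (induction s t n rule: alt.induct) auto

lemma set_alt_ge2: "n \<ge> 2 \<Longrightarrow> set (alt s t n) = {s, t}"
  using set_alt[of s t n] by (cases n; cases "n - 1") auto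

text \<open>A Coxeter matrix on the whole type of generators. The entry \<open>0\<close> stands for infinity, that is,
  for the absence of a relation; the diagonal is never used.\<close>

locale coxeter_matrix =
  fixes m :: "'a \<Rightarrow> 'a \<Rightarrow> nat"
  assumes m_sym: "m s t = m t s"
    and m_ne_1: "m s t \<noteq> 1"
begin

text \<open>\<open>\<approx>\<close> is equality in the Artin--Tits monoid, \<open>\<sim>\<close> is equality in the Coxeter group. Since generators
  are involutions in the latter, inverses are reversals and no signed letters are needed.\<close>

definition braid_step :: "'a list \<Rightarrow> 'a list \<Rightarrow> bool" where
  "braid_step u v \<longleftrightarrow> (\<exists>x y s t. s \<noteq> t \<and> m s t \<noteq> 0 \<and>
     u = x @ alt s t (m s t) @ y \<and> v = x @ alt t s (m s t) @ y)"

definition square_step :: "'a list \<Rightarrow> 'a list \<Rightarrow> bool" where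
  "square_step u v \<longleftrightarrow> (\<exists>x y s. u = x @ [s, s] @ y \<and> v = x @ y)"

definition braid_eq :: "'a list \<Rightarrow> 'a list \<Rightarrow> bool"  (infix "\<approx>" 50) where
  "u \<approx> v \<longleftrightarrow> braid_step\<^sup>*\<^sup>* u v"

definition cox_step :: "'a list \<Rightarrow> 'a list \<Rightarrow> bool" where
  "cox_step u v \<longleftrightarrow> braid_step u v \<or> square_step u v \<or> square_step v u"

definition cox_eq :: "'a list \<Rightarrow> 'a list \<Rightarrow> bool"  (infix "\<sim>" 50) where
  "u \<sim> v \<longleftrightarrow> cox_step\<^sup>*\<^sup>* u v"

lemma braid_step_sym: "braid_step u v \<Longrightarrow> braid_step v u"
  unfolding braid_step_def by (metis m_sym)

lemma braid_refl [simp, intro]: "u \<approx> u"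
  by (simp add: braid_eq_def)

lemma braid_trans [trans]: "u \<approx> v \<Longrightarrow> v \<approx> w \<Longrightarrow> u \<approx> w"
  unfolding braid_eq_def by (rule rtranclp_trans)

lemma braid_sym: "u \<approx> v \<Longrightarrow> v \<approx> u"
  unfolding braid_eq_def
  by (metis (no_types, lifting) braid_step_sym sympI symp_rtranclp sympD)

lemma braid_step_context: "braid_step u v \<Longrightarrow> braid_step (x @ u @ y) (x @ v @ y)"
  unfolding braid_step_def
  by (elim exE conjE, rule_tac x = "x @ xa" in exI, rule_tac x = "ya @ y" in exI) auto

lemma braid_context: "u \<approx> v \<Longrightarrow> x @ u @ y \<approx> x @ v @ y"
  unfolding braid_eq_def
proof (induction rule: rtranclp_induct)
  case (step v w)
  then show ?case by (meson braid_step_context rtranclp.rtrancl_into_rtrancl)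
qed simp

lemma braid_append: "u \<approx> u' \<Longrightarrow> v \<approx> v' \<Longrightarrow> u @ v \<approx> u' @ v'"
  using braid_context[of u u' "[]" v] braid_context[of v v' u' "[]"] braid_trans by auto

lemma braid_Cons: "u \<approx> v \<Longrightarrow> s # u \<approx> s # v"
  using braid_context[of u v "[s]" "[]"] by simp

lemma braid_rel: "s \<noteq> t \<Longrightarrow> m s t \<noteq> 0 \<Longrightarrow> alt s t (m s t) \<approx> alt t s (m s t)"
  unfolding braid_eq_def braid_step_def
  by (rule r_into_rtranclp, rule exI[of _ "[]"], rule exI[of _ "[]"]) auto

lemma m_ge2: "m s t \<noteq> 0 \<Longrightarrow> m s t \<ge> 2"
  using m_ne_1[of s t] by linarith

lemma braid_step_length_set: "braid_step u v \<Longrightarrow> length u = length v \<and> set u = set v"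
  unfolding braid_step_def using m_ge2 by (auto simp: set_alt_ge2)

lemma braid_length_set: "u \<approx> v \<Longrightarrow> length u = length v \<and> set u = set v"
  unfolding braid_eq_def
proof (induction rule: rtranclp_induct)
  case (step v w)
  then show ?case using braid_step_length_set[of v w] by auto
qed simp

lemmas braid_length = braid_length_set[THEN conjunct1]
lemmas braid_set = braid_length_set[THEN conjunct2]

lemma cox_refl [simp, intro]: "u \<sim> u"
  by (simp add: cox_eq_def)

lemma cox_trans [trans]: "u \<sim> v \<Longrightarrow> v \<sim> w \<Longrightarrow> u \<sim> w"
  unfolding cox_eq_def by (rule rtranclp_trans)

lemma cox_sym: "u \<sim> v \<Longrightarrow> v \<sim> u"
proof -
  assume "u \<sim> v"
  moreover have "symp cox_step"
    using braid_step_sym by (auto intro!: sympI simp: cox_step_def)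
  ultimately show ?thesis
    unfolding cox_eq_def by (meson sympD symp_rtranclp)
qed

lemma cox_eq_induct [consumes 1, case_names refl braid square square_rev]:
  assumes "u \<sim> v" "P u"
    and "\<And>v w. u \<sim> v \<Longrightarrow> P v \<Longrightarrow> braid_step v w \<Longrightarrow> P w"
    and "\<And>v w. u \<sim> v \<Longrightarrow> P v \<Longrightarrow> square_step v w \<Longrightarrow> P w"
    and "\<And>v w. u \<sim> v \<Longrightarrow> P v \<Longrightarrow> square_step w v \<Longrightarrow> P w"
  shows "P v"
  using assms(1) unfolding cox_eq_def
proof (induction rule: rtranclp_induct)
  case (step v w)
  then show ?case using assms(3-5)[of v w] by (auto simp: cox_eq_def cox_step_def)
qed (fact assms(2))

lemma braid_imp_cox: "u \<approx> v \<Longrightarrow> u \<sim> v"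
  unfolding braid_eq_def cox_eq_def by (erule rtranclp_mono[THEN predicate2D, rotated]) (auto simp: cox_step_def)

lemma square_step_context: "square_step u v \<Longrightarrow> square_step (x @ u @ y) (x @ v @ y)"
  unfolding square_step_def
  by (elim exE conjE, rule_tac x = "x @ xa" in exI, rule_tac x = "ya @ y" in exI) auto

lemma cox_step_context: "cox_step u v \<Longrightarrow> cox_step (x @ u @ y) (x @ v @ y)"
  unfolding cox_step_def using braid_step_context square_step_context by blast

lemma cox_context: "u \<sim> v \<Longrightarrow> x @ u @ y \<sim> x @ v @ y"
  unfolding cox_eq_def
proof (induction rule: rtranclp_induct)
  case (step v w)
  then show ?case
    by (meson cox_step_context rtranclp.rtrancl_into_rtrancl)
qed simp

lemma cox_append: "u \<sim> u' \<Longrightarrow> v \<sim> v' \<Longrightarrow> u @ v \<sim> u' @ v'"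
  using cox_context[of u u' "[]" v] cox_context[of v v' u' "[]"] cox_trans by auto

lemma cox_Cons: "u \<sim> v \<Longrightarrow> s # u \<sim> s # v"
  using cox_context[of u v "[s]" "[]"] by simp

lemma cox_square: "s # s # u \<sim> u"
  unfolding cox_eq_def cox_step_def square_step_def
  by (rule r_into_rtranclp, rule disjI2, rule disjI1, rule exI[of _ "[]"]) auto

lemma cox_rev_cancel: "rev u @ u @ v \<sim> v"
proof (induction u arbitrary: v)
  case (Cons s u)
  have "rev u @ [s, s] @ u @ v \<sim> rev u @ u @ v"
    using cox_context[OF cox_square, of "rev u" s "u @ v" "[]"] by simp
  then show ?case using cox_trans[OF _ Cons] by simp
qed simp

lemma cox_cancel_rev: "u @ rev u @ v \<sim> v"
  using cox_rev_cancel[of "rev u"] by simp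

lemma cox_cancel_left: "u @ v \<sim> u @ w \<longleftrightarrow> v \<sim> w"
  by (meson cox_append cox_refl cox_rev_cancel cox_sym cox_trans)

lemma cox_cancel_left_Cons: "s # v \<sim> s # w \<longleftrightarrow> v \<sim> w"
  using cox_cancel_left[of "[s]"] by simp

lemma cox_cancel_right: "v @ u \<sim> w @ u \<longleftrightarrow> v \<sim> w"
proof
  assume "v @ u \<sim> w @ u"
  then have "(v @ u) @ rev u \<sim> (w @ u) @ rev u" by (rule cox_append) simp
  moreover have "x @ u @ rev u \<sim> x" for x
    using cox_context[OF cox_cancel_rev[of u "[]"], of x "[]"] by simp
  ultimately show "v \<sim> w" by (metis append_assoc cox_sym cox_trans)
qed (simp add: cox_append)

lemma cox_move_left: "u @ v \<sim> w \<longleftrightarrow> v \<sim> rev u @ w"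
  by (meson cox_cancel_left cox_cancel_rev cox_sym cox_trans)

lemma cox_move_left_Cons: "s # v \<sim> w \<longleftrightarrow> v \<sim> s # w"
  using cox_move_left[of "[s]"] by simp

lemma cox_move_right: "v @ u \<sim> w \<longleftrightarrow> v \<sim> w @ rev u"
proof -
  have "(w @ rev u) @ u \<sim> w"
    using cox_context[OF cox_rev_cancel[of u "[]"], of w "[]"] by simp
  then show ?thesis by (meson cox_cancel_right cox_sym cox_trans)
qed

lemma cox_rev: "u \<sim> v \<Longrightarrow> rev u \<sim> rev v"
  by (metis append_Nil2 cox_move_left cox_move_right cox_sym rev_rev_ident append_Nil)


section \<open>The order of a product of two generators\<close>

text \<open>The Coxeter group acts on the real functions of the generators by the dual of the geometric
  representation: the generator \<open>s\<close> adds to each value \<open>f r\<close> the multiple \<open>weight s r\<close> of \<open>f s\<close>.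
  On this dual side no finiteness of the set of generators is needed. The action serves only to
  show that a product of two generators has the order prescribed by the matrix.\<close>

definition weight :: "'a \<Rightarrow> 'a \<Rightarrow> real" where
  "weight s t = (if s = t then -2 else if m s t = 0 then 2 else 2 * cos (pi / m s t))"

definition fire :: "'a \<Rightarrow> ('a \<Rightarrow> real) \<Rightarrow> 'a \<Rightarrow> real" where
  "fire s f = (\<lambda>r. f r + weight s r * f s)"

text \<open>The action of a word, the first letter acting first.\<close>

fun fires :: "'a list \<Rightarrow> ('a \<Rightarrow> real) \<Rightarrow> 'a \<Rightarrow> real" where
  "fires [] f = f"
| "fires (s # u) f = fires u (fire s f)"

lemma fires_append: "fires (u @ v) f = fires v (fires u f)"
  by (induction u arbitrary: f) auto

lemma weight_sym: "weight s t = weight t s"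
  unfolding weight_def using m_sym[of s t] by auto

lemma fire_fire: "fire s (fire s f) = f"
  by (auto simp: fire_def weight_def)

text \<open>Chebyshev recursion with a shifted index: \<open>cheb (2 cos x) n = sin ((n - 1) x) / sin x\<close> if \<open>sin x\<close> is not zero. They
  are the coefficients that appear when two generators act alternately.\<close>

fun cheb :: "real \<Rightarrow> nat \<Rightarrow> real" where
  "cheb c 0 = -1"
| "cheb c (Suc 0) = 0"
| "cheb c (Suc (Suc n)) = c * cheb c (Suc n) - cheb c n"

lemma cheb_rec: "cheb c (n + 2) = c * cheb c (Suc n) - cheb c n"
  by simp

lemma fires_alt:
  assumes "s \<noteq> t"
  shows "fires (alt s t n) f (if even n then s else t) =
           f s * cheb (weight s t) (n + 2) + f t * cheb (weight s t) (n + 1)"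
    and "fires (alt s t n) f (if even n then t else s) =
           - (f s * cheb (weight s t) (n + 1) + f t * cheb (weight s t) n)"
  using assms
proof (induction n arbitrary: s t f)
  case (Suc n)
  {
    case 1
    have "fires (alt t s n) (fire s f) (if even n then t else s) =
       fire s f t * cheb (weight s t) (n + 2) + fire s f s * cheb (weight s t) (n + 1)"
      using Suc.IH(1)[OF 1[symmetric], of "fire s f"] unfolding weight_sym[of t s] .
    moreover have "fire s f t = f t + weight s t * f s" "fire s f s = - f s"
      by (auto simp: fire_def weight_def)
    ultimately show ?case by (cases "even n") (simp_all add: algebra_simps)
  next
    case 2
    have "fires (alt t s n) (fire s f) (if even n then s else t) =
       - (fire s f t * cheb (weight s t) (n + 1) + fire s f s * cheb (weight s t) n)"
      using Suc.IH(2)[OF 2[symmetric], of "fire s f"] unfolding weight_sym[of t s] .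
    moreover have "fire s f t = f t + weight s t * f s" "fire s f s = - f s"
      by (auto simp: fire_def weight_def)
    ultimately show ?case by (cases "even n") (simp_all add: algebra_simps)
  }
qed auto

lemma cheb_infinite: "cheb 2 n = real n - 1"
  by (induction "2 :: real" n rule: cheb.induct) auto

lemma cheb_sin: "cheb (2 * cos x) n * sin x = sin ((real n - 1) * x)"
proof (induction "2 * cos x" n rule: cheb.induct)
  case (3 n)
  have "sin ((real n + 1) * x) + sin ((real n - 1) * x) = 2 * cos x * sin (real n * x)"
    by (simp add: algebra_simps sin_add sin_diff)
  then show ?case using 3 by (simp add: algebra_simps)
qed auto

lemma sin_pi_div_pos: "n \<ge> 2 \<Longrightarrow> sin (pi / real n) > 0"
  by (rule sin_gt_zero) (auto simp: field_simps)

lemma cheb_finite: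
  assumes "n \<ge> 2"
  defines "c \<equiv> 2 * cos (pi / real n)"
  shows "cheb c n = 1" "cheb c (n + 1) = 0" "cheb c (n + 2) = -1"
proof -
  let ?x = "pi / real n"
  have p: "sin ?x > 0" using sin_pi_div_pos assms(1) by simp
  have n: "real n * ?x = pi" using assms(1) by simp
  have "(real n - 1) * ?x = pi - ?x" unfolding left_diff_distrib n by simp
  then have "cheb c n * sin ?x = sin ?x"
    unfolding c_def cheb_sin by simp
  then show 1: "cheb c n = 1" using p by simp
  have "cheb c (n + 1) * sin ?x = 0"
    unfolding c_def cheb_sin using assms(1) by simp
  then show 2: "cheb c (n + 1) = 0" using p by simp
  show "cheb c (n + 2) = -1" using cheb_rec[of c n] 1 2 by simp
qed

text \<open>The values \<open>p\<close> and \<open>q\<close> are chosen so that \<open>f r + p * f s + q * f t\<close> is fixed by \<open>s\<close> and \<open>t\<close>; hence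
  two words in \<open>s\<close> and \<open>t\<close> that act equally on the values at \<open>s\<close> and \<open>t\<close> do so on the value at \<open>r\<close>.\<close>

lemma fires_invariant:
  assumes "set u \<subseteq> {s, t}" "weight s r - 2 * p + weight s t * q = 0"
    "weight t r - 2 * q + weight s t * p = 0"
  shows "fires u f r + p * fires u f s + q * fires u f t = f r + p * f s + q * f t"
  using assms(1)
proof (induction u arbitrary: f)
  case (Cons x u)
  have "fire x f r + p * fire x f s + q * fire x f t = f r + p * f s + q * f t"
  proof (cases "x = s")
    case True
    have "fire x f r + p * fire x f s + q * fire x f t
      = f r + p * f s + q * f t + f s * (weight s r - 2 * p + weight s t * q)"
      unfolding True fire_def by (simp add: weight_def[of s s] algebra_simps)
    then show ?thesis using assms(2) by simp
  next
    case False
    then have x: "x = t" using Cons.prems by simp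
    have "fire x f r + p * fire x f s + q * fire x f t
      = f r + p * f s + q * f t + f t * (weight t r - 2 * q + weight s t * p)"
      unfolding x fire_def by (simp add: weight_def[of t t] weight_sym[of t s] algebra_simps)
    then show ?thesis using assms(3) by simp
  qed
  then show ?case using Cons by simp
qed simp

lemma fires_braid:
  assumes "s \<noteq> t" "m s t \<noteq> 0"
  shows "fires (alt s t (m s t)) f = fires (alt t s (m s t)) f"
proof
  fix r
  let ?n = "m s t" and ?c = "weight s t"
  have n: "?n \<ge> 2" using m_ge2 assms(2) .
  have c: "?c = 2 * cos (pi / ?n)" using assms by (simp add: weight_def)
  note ch = cheb_finite[OF n, folded c]
  have s: "fires (alt s t ?n) f s = fires (alt t s ?n) f s"
   and t: "fires (alt s t ?n) f t = fires (alt t s ?n) f t"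
    using fires_alt[OF assms(1), of ?n f] fires_alt[OF assms(1)[symmetric], of ?n f]
    unfolding ch weight_sym[of t s] by (cases "even ?n"; simp)+
  \<comment> \<open>the linear system for \<open>p\<close> and \<open>q\<close> in the invariance lemma has a nonzero determinant\<close>
  have "cos (pi / ?n) ^ 2 \<noteq> 1"
    using sin_cos_squared_add[of "pi / real ?n"] sin_pi_div_pos[OF n] by (metis add_cancel_left_left less_irrefl power_not_zero)
  then have d: "4 - ?c ^ 2 \<noteq> 0" unfolding c by (simp add: power_mult_distrib)
  define p where "p = (2 * weight s r + ?c * weight t r) / (4 - ?c ^ 2)"
  define q where "q = (2 * weight t r + ?c * weight s r) / (4 - ?c ^ 2)"
  have p: "weight s r - 2 * p + ?c * q = 0"
    unfolding p_def q_def using d by (simp add: field_simps power2_eq_square)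
  have q: "weight t r - 2 * q + ?c * p = 0"
    unfolding p_def q_def using d by (simp add: field_simps power2_eq_square)
  have "fires u f r = f r + p * f s + q * f t - p * fires u f s - q * fires u f t"
    if "set u \<subseteq> {s, t}" for u
    using fires_invariant[OF that p q, of f] by simp
  from this[of "alt s t ?n"] this[of "alt t s ?n"]
  show "fires (alt s t ?n) f r = fires (alt t s ?n) f r"
    using set_alt[of s t ?n] set_alt[of t s ?n] s t by (simp add: insert_commute)
qed

lemma fires_cong: "u \<sim> v \<Longrightarrow> fires u f = fires v f"
proof (induction rule: cox_eq_induct)
  case (braid v w)
  then obtain x y s t where *: "s \<noteq> t" "m s t \<noteq> 0" "v = x @ alt s t (m s t) @ y"
    "w = x @ alt t s (m s t) @ y" by (auto simp: braid_step_def)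
  then show ?case using braid.IH fires_braid[OF *(1,2)] by (simp add: fires_append)
qed (auto simp: square_step_def fires_append fire_fire)

text \<open>The order of the product of two generators is not smaller than the matrix prescribes.\<close>

lemma alt_even_not_one:
  assumes "s \<noteq> t" "0 < i" "m s t = 0 \<or> i < m s t"
  shows "\<not> alt s t (2 * i) \<sim> []"
proof
  assume "alt s t (2 * i) \<sim> []"
  then have "fires (alt s t (2 * i)) f s = f s" for f
    using fires_cong[of _ "[]"] by fastforce
  then have *: "f s = f s * cheb (weight s t) (2 * i + 2) + f t * cheb (weight s t) (2 * i + 1)" for f
    using fires_alt(1)[OF assms(1), of "2 * i"] by simp
  from *[of "\<lambda>x. if x = t then 1 else 0"] assms(1)
  have 1: "cheb (weight s t) (2 * i + 1) = 0" by simp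
  from *[of "\<lambda>x. if x = s then 1 else 0"] assms(1)
  have 2: "cheb (weight s t) (2 * i + 2) = 1" by simp
  show False
  proof (cases "m s t = 0")
    case True
    then show False using 1 assms(1,2) by (simp add: weight_def cheb_infinite)
  next
    case False
    let ?x = "pi / m s t"
    have w: "weight s t = 2 * cos ?x" using False assms(1) by (simp add: weight_def)
    have sp: "sin ?x > 0" using sin_pi_div_pos m_ge2[OF False] by simp
    have s0: "sin (real (2 * i) * ?x) = 0"
      using 1 cheb_sin[of ?x "2 * i + 1"] unfolding w by simp
    have "sin (real (2 * i) * ?x + ?x) = sin ?x"
      using 2 cheb_sin[of ?x "2 * i + 2"] unfolding w by (simp add: algebra_simps)
    then have "cos (real (2 * i) * ?x) = 1"
      using s0 sp by (simp add: sin_add)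
    then obtain k :: int where k: "real (2 * i) * ?x = of_int k * 2 * pi"
      using cos_one_2pi_int by blast
    then have "real i = of_int k * real (m s t)"
      using False by (simp add: field_simps)
    then have e: "int i = k * int (m s t)"
      by (metis (mono_tags, lifting) of_int_eq_iff of_int_mult of_int_of_nat_eq)
    have lt: "i < m s t" using assms(3) False by simp
    have "k > 0" using e assms(2) by (metis of_nat_0_less_iff zero_less_mult_pos2 lt gr_implies_not0 neq0_conv)
    then have "int i \<ge> int (m s t)" unfolding e by (simp add: mult_le_cancel_right1)
    then show False using lt by simp
  qed
qed


section \<open>Reflections and the exchange property\<close>

text \<open>The reflections of a word \<open>u\<close>, one for each letter: if \<open>u = x @ p # y\<close>, the letter \<open>p\<close> gives the word
  \<open>x @ [p] @ rev x\<close>. They are compared modulo \<open>\<sim>\<close>.\<close>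

fun refls :: "'a list \<Rightarrow> 'a list list" where
  "refls [] = []"
| "refls (s # u) = [s] # map (\<lambda>r. s # r @ [s]) (refls u)"

lemma length_refls [simp]: "length (refls u) = length u"
  by (induction u) auto

lemma refls_append: "refls (u @ v) = refls u @ map (\<lambda>r. u @ r @ rev u) (refls v)"
  by (induction u) auto

lemma refls_nth: "i < length u \<Longrightarrow> refls u ! i = take (Suc i) u @ rev (take i u)"
proof (induction u arbitrary: i)
  case (Cons s u)
  then show ?case by (cases i) auto
qed simp

lemma refls_alt_nth:
  assumes "i < n"
  shows "refls (alt s t n) ! i = alt s t (2 * i + 1)"
  using assms
proof (induction s t n arbitrary: i rule: alt.induct)
  case (2 s t n)
  show ?case
  proof (cases i)
    case (Suc j)
    then have "refls (alt s t (Suc n)) ! i = s # alt t s (2 * j + 1) @ [s]"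
      using 2 by simp
    also have "alt t s (2 * j + 1) @ [s] = alt t s (Suc (2 * j + 1))"
      unfolding alt_snoc[of t s "2 * j + 1"] by simp
    finally show ?thesis using Suc by simp
  qed simp
qed simp

text \<open>How often a reflection occurs in a word. The parity of this number depends only on the element
  of the Coxeter group that the word represents; this invariant yields the exchange property.\<close>

definition refl_count :: "'a list \<Rightarrow> 'a list \<Rightarrow> nat" where
  "refl_count u r = length (filter (\<lambda>q. q \<sim> r) (refls u))"

lemma cox_conj_iff: "u @ q @ rev u \<sim> r \<longleftrightarrow> q \<sim> rev u @ r @ u"
  using cox_move_left[of u "q @ rev u" r] cox_move_right[of q "rev u" "rev u @ r"] by simp

lemma refl_count_append: "refl_count (u @ v) r = refl_count u r + refl_count v (rev u @ r @ u)"
  by (simp add: refl_count_def refls_append filter_map o_def cox_conj_iff)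

lemma refl_count_cong: "r \<sim> r' \<Longrightarrow> refl_count u r = refl_count u r'"
proof -
  assume r: "r \<sim> r'"
  have "(\<lambda>q. q \<sim> r) = (\<lambda>q. q \<sim> r')" using r cox_sym cox_trans by blast
  then show ?thesis by (simp add: refl_count_def)
qed

lemma alt_double: "alt s t (2 * n) = alt s t n @ rev (alt t s n)"
  using alt_add[of s t n n] rev_alt[of t s n] by (simp add: mult_2)

text \<open>In a dihedral group of order \<open>2 m\<close> with \<open>m\<close> the entry at \<open>s\<close> and \<open>t\<close>, words of complementary odd
  lengths represent the same reflection.\<close>

lemma alt_cycle:
  assumes "s \<noteq> t" "m s t \<noteq> 0" "p + q = 2 * m s t" "odd p"
  shows "alt s t p \<sim> alt t s q"
proof -
  have "alt s t (2 * m s t) \<sim> []"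
    unfolding alt_double
    using cox_append[OF braid_imp_cox[OF braid_rel[OF assms(1,2)]] cox_refl]
      cox_cancel_rev[of "alt t s (m s t)" "[]"] cox_trans by fastforce
  moreover have "odd q" using assms(3,4) by presburger
  ultimately have "alt s t p @ alt t s q \<sim> []"
    using alt_add[of s t p q] assms(3,4) by simp
  then show ?thesis
    using cox_move_right[of "alt s t p" "alt t s q" "[]"] rev_alt[of t s q] \<open>odd q\<close> by simp
qed

lemma refl_count_braid:
  assumes "s \<noteq> t" "m s t \<noteq> 0"
  shows "refl_count (alt s t (m s t)) r = refl_count (alt t s (m s t)) r"
proof -
  \<comment> \<open>the two words have the same reflections, in opposite orders\<close>
  let ?n = "m s t"
  have eq: "alt s t (2 * i + 1) \<sim> alt t s (2 * (?n - Suc i) + 1)" if "i < ?n" for i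
    by (rule alt_cycle[OF assms]) (use that in auto)
  have "refl_count (alt s t ?n) r = card {i. i < ?n \<and> alt s t (2 * i + 1) \<sim> r}"
    unfolding refl_count_def length_filter_conv_card
    by (rule arg_cong[where f = card]) (auto simp: refls_alt_nth)
  also have "\<dots> = card {i. i < ?n \<and> alt t s (2 * i + 1) \<sim> r}"
  proof (rule bij_betw_same_card[of "\<lambda>i. ?n - Suc i"], rule bij_betw_imageI)
    show "inj_on (\<lambda>i. ?n - Suc i) {i. i < ?n \<and> alt s t (2 * i + 1) \<sim> r}"
      by (auto simp: inj_on_def)
    show "(\<lambda>i. ?n - Suc i) ` {i. i < ?n \<and> alt s t (2 * i + 1) \<sim> r}
      = {i. i < ?n \<and> alt t s (2 * i + 1) \<sim> r}" (is "?f ` ?A = ?B")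
    proof (intro equalityI subsetI)
      fix j assume "j \<in> ?f ` ?A"
      then obtain i where i: "i < ?n" "alt s t (2 * i + 1) \<sim> r" "j = ?f i" by blast
      have "alt t s (2 * j + 1) \<sim> r"
        using cox_trans[OF cox_sym[OF eq[OF i(1)]] i(2)] i(3) by simp
      then show "j \<in> ?B" using i by simp
    next
      fix j assume j: "j \<in> ?B"
      then have "alt t s (2 * (?n - Suc (?n - Suc j)) + 1) \<sim> r" "?n - Suc j < ?n" by auto
      then have "?n - Suc j \<in> ?A" using cox_trans[OF eq[of "?n - Suc j"]] by blast
      moreover have "j = ?f (?n - Suc j)" using j by auto
      ultimately show "j \<in> ?f ` ?A" by blast
    qed
  qed
  also have "\<dots> = refl_count (alt t s ?n) r"
    unfolding refl_count_def length_filter_conv_card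
    by (rule arg_cong[where f = card]) (auto simp: refls_alt_nth)
  finally show ?thesis .
qed

lemma refl_count_context:
  assumes "v \<sim> v'" "\<And>r. even (refl_count v r) = even (refl_count v' r)"
  shows "even (refl_count (x @ v @ y) r) = even (refl_count (x @ v' @ y) r)"
proof -
  have "rev v @ (rev x @ r @ x) @ v \<sim> rev v' @ (rev x @ r @ x) @ v'"
    using assms(1) by (intro cox_append cox_rev) auto
  from refl_count_cong[OF this] show ?thesis
    using assms(2)[of "rev x @ r @ x"] by (simp add: refl_count_append)
qed

lemma refl_count_square:
  assumes "square_step u v"
  shows "even (refl_count u r) = even (refl_count v r)"
proof -
  obtain x y s where u: "u = x @ [s, s] @ y" and v: "v = x @ [] @ y"
    using assms by (auto simp: square_step_def)
  have "[s, s, s] \<sim> r \<longleftrightarrow> [s] \<sim> r" for r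
    using cox_square[of s "[s]"] by (meson cox_sym cox_trans)
  then have "even (refl_count [s, s] r)" for r
    by (simp add: refl_count_def)
  moreover have "[s, s] \<sim> []" using cox_square[of s "[]"] by simp
  ultimately show ?thesis
    unfolding u v by (intro refl_count_context) (auto simp: refl_count_def)
qed

lemma refl_count_parity: "u \<sim> v \<Longrightarrow> even (refl_count u r) = even (refl_count v r)"
proof (induction rule: cox_eq_induct)
  case (braid v w)
  then obtain x y s t where *: "s \<noteq> t" "m s t \<noteq> 0" "v = x @ alt s t (m s t) @ y"
    "w = x @ alt t s (m s t) @ y" by (auto simp: braid_step_def)
  have "even (refl_count v r) = even (refl_count w r)"
    unfolding *(3,4)
    by (rule refl_count_context[OF braid_imp_cox[OF braid_rel[OF *(1,2)]]])
      (simp only: refl_count_braid[OF *(1,2)])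
  then show ?case using braid by simp
qed (simp_all add: refl_count_square)

text \<open>Words of minimal length among those that represent the same element of the Coxeter group.\<close>

definition reduced :: "'a list \<Rightarrow> bool" where
  "reduced u \<longleftrightarrow> (\<forall>v. u \<sim> v \<longrightarrow> length u \<le> length v)"

lemma reduced_Nil [simp]: "reduced []"
  by (simp add: reduced_def)

lemma reduced_cong_length: "u \<sim> v \<Longrightarrow> length u = length v \<Longrightarrow> reduced u \<Longrightarrow> reduced v"
  unfolding reduced_def by (metis cox_trans)

lemma reduced_length_eq: "u \<sim> v \<Longrightarrow> reduced u \<Longrightarrow> reduced v \<Longrightarrow> length u = length v"
  unfolding reduced_def by (meson cox_sym le_antisym)

lemma reduced_factor: "reduced (x @ u @ y) \<Longrightarrow> reduced u"
  unfolding reduced_def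
proof (intro allI impI)
  fix v assume *: "\<forall>v. x @ u @ y \<sim> v \<longrightarrow> length (x @ u @ y) \<le> length v" "u \<sim> v"
  then have "length (x @ u @ y) \<le> length (x @ v @ y)" using cox_context by blast
  then show "length u \<le> length v" by simp
qed

lemma reduced_appendD1: "reduced (u @ v) \<Longrightarrow> reduced u"
  using reduced_factor[of "[]" u v] by simp

lemma reduced_appendD2: "reduced (u @ v) \<Longrightarrow> reduced v"
  using reduced_factor[of u v "[]"] by simp

lemma reduced_ConsD: "reduced (s # u) \<Longrightarrow> reduced u"
  using reduced_appendD2[of "[s]" u] by simp

lemma reduced_rev: "reduced (rev u) \<longleftrightarrow> reduced u"
proof -
  have "reduced u \<Longrightarrow> reduced (rev u)" for u
    unfolding reduced_def by (metis cox_rev length_rev rev_rev_ident)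
  from this[of u] this[of "rev u"] show ?thesis by auto
qed

definition distinct_refls :: "'a list \<Rightarrow> bool" where
  "distinct_refls u \<longleftrightarrow>
     (\<forall>i j. i < j \<longrightarrow> j < length u \<longrightarrow> \<not> refls u ! i \<sim> refls u ! j)"

text \<open>Two equal reflections of a word give two letters that can be deleted.\<close>

lemma refls_eq_delete:
  assumes "i < j" "j < length u" "refls u ! i \<sim> refls u ! j"
  shows "u \<sim> take i u @ drop (Suc i) (take j u) @ drop (Suc j) u"
proof -
  define x where "x = take i u"
  define y where "y = drop (Suc i) (take j u)"
  define z where "z = drop (Suc j) u"
  have i: "take (Suc i) u = x @ [u ! i]"
    using assms x_def by (simp add: take_Suc_conv_app_nth)
  have "take j u = take (Suc i) u @ y"
    using append_take_drop_id[of "Suc i" "take j u"] assms(1) by (simp add: y_def min_absorb1)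
  then have ij: "take j u = x @ [u ! i] @ y" unfolding i by simp
  have j: "take (Suc j) u = (x @ [u ! i] @ y) @ [u ! j]"
    using assms ij by (simp add: take_Suc_conv_app_nth)
  have u: "u = x @ [u ! i] @ y @ [u ! j] @ z"
    using append_take_drop_id[of "Suc j" u] unfolding j z_def by simp
  have "refls u ! i = x @ [u ! i] @ rev x" using refls_nth[of i u] assms i x_def by simp
  moreover have "refls u ! j = x @ [u ! i] @ y @ [u ! j] @ rev y @ [u ! i] @ rev x"
    using refls_nth[of j u] assms j ij by simp
  ultimately have "x @ [u ! i] @ rev x \<sim> x @ [u ! i] @ y @ [u ! j] @ rev y @ [u ! i] @ rev x"
    using assms(3) by simp
  then have "rev x \<sim> (y @ [u ! j] @ rev y @ [u ! i]) @ rev x"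
    unfolding cox_cancel_left by simp
  then have "[] @ rev x \<sim> (y @ [u ! j] @ rev y @ [u ! i]) @ rev x" by simp
  then have "[] \<sim> (y @ [u ! j] @ rev y) @ [u ! i]"
    unfolding cox_cancel_right by simp
  then have "[u ! i] \<sim> (y @ [u ! j]) @ rev y"
    using cox_move_right[of "y @ [u ! j] @ rev y" "[u ! i]" "[]"] cox_sym by auto
  then have "[u ! i] @ y \<sim> y @ [u ! j]"
    using cox_move_right[of "[u ! i]" y "y @ [u ! j]"] by simp
  then have "[u ! i] @ y @ [u ! j] \<sim> y"
    using cox_move_right[of y "[u ! j]" "[u ! i] @ y"] cox_move_right[of "[u ! i] @ y" "[u ! j]" y] by simp
  from cox_context[OF this, of x z] show ?thesis
    unfolding x_def[symmetric] y_def[symmetric] z_def[symmetric] using u by simp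
qed

lemma reduced_distinct_refls:
  assumes "reduced u"
  shows "distinct_refls u"
  unfolding distinct_refls_def
proof (intro allI impI notI)
  fix i j assume *: "i < j" "j < length u" "refls u ! i \<sim> refls u ! j"
  from refls_eq_delete[OF this] assms
  have "length u \<le> length (take i u @ drop (Suc i) (take j u) @ drop (Suc j) u)"
    unfolding reduced_def by blast
  then show False using * by simp
qed

text \<open>A reflection that occurs exactly once occurs an odd number of times in every word for the same
  element, so no such word can have fewer letters.\<close>

lemma distinct_refls_reduced:
  assumes "distinct_refls u"
  shows "reduced u"
  unfolding reduced_def
proof (intro allI impI)
  fix v assume uv: "u \<sim> v"
  have ex: "\<exists>j<length v. refls v ! j \<sim> refls u ! i" if "i < length u" for i
  proof -
    have "j = i" if "j < length u" "refls u ! j \<sim> refls u ! i" for j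
      using assms \<open>i < length u\<close> that cox_sym unfolding distinct_refls_def
      by (metis linorder_neqE_nat)
    then have "{j. j < length u \<and> refls u ! j \<sim> refls u ! i} = {i}"
      using \<open>i < length u\<close> by auto
    then have "refl_count u (refls u ! i) = 1"
      unfolding refl_count_def length_filter_conv_card by simp
    then have "refl_count v (refls u ! i) \<noteq> 0"
      using refl_count_parity[OF uv, of "refls u ! i"] by (metis even_zero odd_one)
    then have "filter (\<lambda>q. q \<sim> refls u ! i) (refls v) \<noteq> []"
      unfolding refl_count_def by simp
    then show ?thesis by (auto simp: filter_empty_conv in_set_conv_nth)
  qed
  then obtain f where f: "\<And>i. i < length u \<Longrightarrow> f i < length v \<and> refls v ! f i \<sim> refls u ! i"
    by metis
  have "inj_on f {..<length u}"
  proof (rule inj_onI)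
    fix i j assume *: "i \<in> {..<length u}" "j \<in> {..<length u}" "f i = f j"
    then have "refls u ! i \<sim> refls u ! j" using f by (metis cox_sym cox_trans lessThan_iff)
    then show "i = j" using assms * cox_sym unfolding distinct_refls_def
      by (metis lessThan_iff linorder_neqE_nat)
  qed
  moreover have "f ` {..<length u} \<subseteq> {..<length v}" using f by auto
  ultimately show "length u \<le> length v"
    by (metis card_inj_on_le card_lessThan finite_lessThan)
qed

lemma not_reduced_delete:
  assumes "\<not> reduced u"
  shows "\<exists>v. u \<sim> v \<and> length v < length u \<and> set v \<subseteq> set u"
proof -
  obtain i j where *: "i < j" "j < length u" "refls u ! i \<sim> refls u ! j"
    using assms distinct_refls_reduced distinct_refls_def by blast
  have "set (take i u @ drop (Suc i) (take j u) @ drop (Suc j) u) \<subseteq> set u"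
    by (auto dest: in_set_takeD in_set_dropD)
  then show ?thesis
    using refls_eq_delete[OF *] *(1,2)
    by (intro exI[of _ "take i u @ drop (Suc i) (take j u) @ drop (Suc j) u"]) auto
qed

lemma ex_reduced: "\<exists>v. u \<sim> v \<and> reduced v \<and> set v \<subseteq> set u"
proof (induction u rule: length_induct)
  case (1 u)
  show ?case
  proof (cases "reduced u")
    case False
    then show ?thesis using not_reduced_delete[OF False] 1 by (meson cox_trans order_trans)
  qed auto
qed

text \<open>The exchange property, in the form \<open>s x = x p\<close>: multiplying \<open>u\<close> by \<open>s\<close> amounts to deleting the
  letter \<open>p\<close>.\<close>

lemma exchange:
  assumes "reduced u" "\<not> reduced (s # u)"
  shows "\<exists>x p y. u = x @ p # y \<and> s # x \<sim> x @ [p]"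
proof -
  obtain i j where ij: "i < j" "j < length (s # u)" "refls (s # u) ! i \<sim> refls (s # u) ! j"
    using assms(2) distinct_refls_reduced distinct_refls_def by blast
  then obtain k where k: "j = Suc k" by (cases j) auto
  have i: "i = 0"
  proof (rule ccontr)
    assume "i \<noteq> 0"
    then obtain l where l: "i = Suc l" by (cases i) auto
    have "s # (refls u ! l) @ [s] \<sim> s # (refls u ! k) @ [s]"
      using ij k l by simp
    then have "refls u ! l \<sim> refls u ! k"
      unfolding cox_cancel_left_Cons cox_cancel_right .
    then show False
      using reduced_distinct_refls[OF assms(1)] ij k l unfolding distinct_refls_def by auto
  qed
  define x where "x = take k u"
  have u: "u = x @ u ! k # drop (Suc k) u" using ij k x_def id_take_nth_drop by auto
  have "refls u ! k = x @ [u ! k] @ rev x"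
    using refls_nth[of k u] ij k by (simp add: x_def take_Suc_conv_app_nth)
  then have "[s] \<sim> s # (x @ [u ! k] @ rev x) @ [s]"
    using ij i k by simp
  then have "[] @ [s] \<sim> (s # x @ [u ! k] @ rev x) @ [s]" by simp
  then have "[] \<sim> s # x @ [u ! k] @ rev x" unfolding cox_cancel_right .
  then have "(s # x @ [u ! k]) @ rev x \<sim> []" using cox_sym by simp
  then have "s # x @ [u ! k] \<sim> x" using cox_move_right[of "s # x @ [u ! k]" "rev x" "[]"] by simp
  then have "s # x \<sim> x @ [u ! k]"
    using cox_move_left_Cons[of s "x @ [u ! k]" x] cox_sym by blast
  then show ?thesis using u by blast
qed

lemma exchange_right:
  assumes "reduced u" "\<not> reduced (u @ [s])"
  shows "\<exists>x p y. u = x @ p # y \<and> y @ [s] \<sim> p # y"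
proof -
  have "reduced (rev u)" "\<not> reduced (s # rev u)"
    using assms reduced_rev[of u] reduced_rev[of "u @ [s]"] by auto
  then obtain x p y where "rev u = x @ p # y" and *: "s # x \<sim> x @ [p]"
    using exchange by blast
  then have "u = rev y @ p # rev x" by (metis rev_append rev.simps(2) rev_rev_ident append_assoc append_Cons append_Nil)
  then show ?thesis using cox_rev[OF *] by auto
qed

text \<open>Moving a left descent in front of a prefix that it does not shorten.\<close>

lemma exchange_past_prefix:
  assumes "reduced (a @ v)" "\<not> reduced (s # a @ v)" "reduced (s # a)"
  shows "\<exists>v'. a @ v \<sim> s # a @ v' \<and> length v = Suc (length v') \<and> set v' \<subseteq> set v"
proof -
  obtain x p y where *: "a @ v = x @ p # y" "s # x \<sim> x @ [p]"
    using exchange[OF assms(1,2)] by blast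
  consider q where "x = a @ q" "v = q @ p # y" | z where "a = x @ p # z"
    using *(1) by (auto simp: append_eq_append_conv2 append_eq_Cons_conv)
  then show ?thesis
  proof cases
    case 1
    have "s # a @ q @ y \<sim> a @ v"
      using cox_append[OF *(2), of y y] by (simp add: 1)
    then show ?thesis using 1 cox_sym by (intro exI[of _ "q @ y"]) auto
  next
    case 2
    have "(s # x) @ p # z \<sim> (x @ [p]) @ p # z"
      by (rule cox_append[OF *(2) cox_refl])
    also have "(x @ [p]) @ p # z \<sim> x @ z"
      using cox_context[OF cox_square, of x p z "[]"] by simp
    finally have "s # a \<sim> x @ z" using 2 by simp
    moreover have "length (x @ z) < length (s # a)" using 2 by simp
    ultimately show ?thesis using assms(3) unfolding reduced_def by (meson not_le)
  qed
qed


section \<open>Alternating words and descents\<close>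

text \<open>The lengths up to which alternating words are reduced.\<close>

definition alt_ok :: "'a \<Rightarrow> 'a \<Rightarrow> nat \<Rightarrow> bool" where
  "alt_ok s t k \<longleftrightarrow> m s t = 0 \<or> k \<le> m s t"

lemma reduced_alt:
  assumes "s \<noteq> t" "alt_ok s t k"
  shows "reduced (alt s t k)"
proof (rule distinct_refls_reduced, unfold distinct_refls_def, intro allI impI notI)
  fix i j assume ij: "i < j" "j < length (alt s t k)" "refls (alt s t k) ! i \<sim> refls (alt s t k) ! j"
  then have "alt s t (2 * i + 1) \<sim> alt s t (2 * j + 1)" by (simp add: refls_alt_nth)
  moreover have "2 * j + 1 = 2 * (j - i) + (2 * i + 1)" using ij(1) by simp
  then have "alt s t (2 * j + 1) = alt s t (2 * (j - i)) @ alt s t (2 * i + 1)"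
    by (simp only: alt_add) simp
  ultimately have "[] @ alt s t (2 * i + 1) \<sim> alt s t (2 * (j - i)) @ alt s t (2 * i + 1)" by simp
  then have "alt s t (2 * (j - i)) \<sim> []" unfolding cox_cancel_right by (rule cox_sym)
  moreover have "j - i < k" using ij(1,2) by simp
  then have "m s t = 0 \<or> j - i < m s t" using assms(2) unfolding alt_ok_def by linarith
  ultimately show False
    using alt_even_not_one[OF assms(1), of "j - i"] ij(1) by simp
qed

lemma reduced_letter: "reduced [s]"
proof (rule ccontr)
  assume "\<not> reduced [s]"
  from not_reduced_delete[OF this] have "[s] \<sim> []" by auto
  from refl_count_parity[OF this, of "[s]"] show False by (simp add: refl_count_def)
qed

lemma reduced_Cons_cong: "u \<sim> v \<Longrightarrow> length u = length v \<Longrightarrow> reduced (s # u) = reduced (s # v)"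
  by (metis cox_Cons cox_sym length_Cons reduced_cong_length)

text \<open>A reduced word with two distinct left descents starts, up to equality in the group, with
  the longest alternating word in these two letters.\<close>

lemma two_descents:
  assumes "reduced w" "\<not> reduced (s # w)" "\<not> reduced (t # w)" "s \<noteq> t"
  shows "m s t \<noteq> 0 \<and> (\<exists>v. w \<sim> alt s t (m s t) @ v \<and> length w = m s t + length v)"
proof -
  have step: "\<exists>v. w \<sim> alt s t k @ v \<and> length w = k + length v"
    if "s \<noteq> t" "alt_ok s t k" "\<not> reduced (s # w)" "\<not> reduced (t # w)" for s t k
    using that
  proof (induction k arbitrary: s t)
    case (Suc k)
    then have "alt_ok t s k" using m_sym[of s t] by (auto simp: alt_ok_def)
    then obtain v where v: "w \<sim> alt t s k @ v" "length w = k + length v"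
      using Suc.IH[of t s] Suc.prems by auto
    have "reduced (alt t s k @ v)" using reduced_cong_length[OF v(1)] v(2) assms(1) by simp
    moreover have "\<not> reduced (s # alt t s k @ v)"
      using reduced_Cons_cong[OF v(1), of s] v(2) Suc.prems(3) by simp
    moreover have "reduced (s # alt t s k)"
      using reduced_alt[OF Suc.prems(1,2)] by simp
    ultimately obtain v' where v': "alt t s k @ v \<sim> s # alt t s k @ v'" "length v = Suc (length v')"
      using exchange_past_prefix by blast
    then show ?case using cox_trans[OF v(1) v'(1)] v(2) by (intro exI[of _ v']) auto
  qed auto
  have "m s t \<noteq> 0"
  proof
    assume "m s t = 0"
    then obtain v where "length w = Suc (length w) + length v"
      using step[of s t "Suc (length w)"] assms by (auto simp: alt_ok_def)
    then show False by simp
  qed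
  then show ?thesis using step[of s t "m s t"] assms by (auto simp: alt_ok_def)
qed

lemma not_reduced_Cons_Cons: "\<not> reduced (s # s # u)"
  unfolding reduced_def using cox_square by (metis Suc_n_not_le_n length_Cons Suc_leD)

lemma alt_pred: "m s t \<noteq> 0 \<Longrightarrow> alt s t (m s t) = s # alt t s (m s t - 1)"
  by (cases "m s t") auto

text \<open>Matsumoto's theorem. Two reduced words for the same element with distinct first letters are both
  compared with a word that starts with the alternating word in these letters.\<close>

theorem matsumoto:
  assumes "reduced u" "reduced v" "u \<sim> v"
  shows "u \<approx> v"
  using assms
proof (induction "length u" arbitrary: u v)
  case 0
  then show ?case using reduced_length_eq[of "[]" v] by simp
next
  case (Suc n w)
  then obtain s u where w: "w = s # u" by (cases w) auto
  have prems: "reduced (s # u)" "reduced v" "s # u \<sim> v" and n: "n = length u"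
    using Suc.prems Suc.hyps(2) w by auto
  note IH = Suc.hyps(1)
  have len: "length v = Suc (length u)" using reduced_length_eq[OF prems(3,1,2)] by simp
  then obtain t v1 where v: "v = t # v1" by (cases v) auto
  have ru: "reduced u" using reduced_ConsD prems(1) by blast
  show ?case
  proof (cases "s = t")
    case True
    have "u \<sim> v1" using prems(3) unfolding v True cox_cancel_left_Cons .
    moreover have "reduced v1" using prems(2) unfolding v by (rule reduced_ConsD)
    ultimately have "u \<approx> v1" using IH[OF n ru] by simp
    then show ?thesis unfolding w v True by (rule braid_Cons)
  next
    case False
    have "\<not> reduced (t # s # u)"
      using reduced_Cons_cong[OF prems(3), of t] len v not_reduced_Cons_Cons by simp
    from two_descents[OF prems(1) not_reduced_Cons_Cons this False]
    obtain x where m: "m s t \<noteq> 0" and x: "s # u \<sim> alt s t (m s t) @ x"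
      "length (s # u) = m s t + length x" by auto
    have rx: "reduced (alt s t (m s t) @ x)"
      using reduced_cong_length[OF x(1)] x(2) prems(1) by simp
    have b: "alt s t (m s t) @ x \<approx> alt t s (m s t) @ x"
      by (intro braid_append braid_rel False m) simp
    have ry: "reduced (alt t s (m s t) @ x)"
      using reduced_cong_length[OF braid_imp_cox[OF b]] rx by simp
    let ?a = "alt t s (m s t - 1) @ x" and ?b = "alt s t (m s t - 1) @ x"
    have a: "alt s t (m s t) @ x = s # ?a" using alt_pred[OF m] by simp
    have b': "alt t s (m s t) @ x = t # ?b" using alt_pred[of t s] m m_sym[of s t] by simp
    have ua: "u \<sim> ?a" using x(1) unfolding a cox_cancel_left_Cons .
    have ra: "reduced ?a" using rx unfolding a by (rule reduced_ConsD)
    have "u \<approx> ?a" by (rule IH[OF n ru ra ua])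
    then have 1: "s # u \<approx> alt t s (m s t) @ x"
      using braid_trans[OF braid_Cons b[unfolded a]] by blast
    have "t # v1 \<sim> t # ?b"
      using cox_trans[OF cox_sym[OF prems(3)] braid_imp_cox[OF 1]] unfolding v b' .
    then have "v1 \<sim> ?b" unfolding cox_cancel_left_Cons .
    have rb: "reduced ?b" using ry unfolding b' by (rule reduced_ConsD)
    have "reduced v1" using prems(2) unfolding v by (rule reduced_ConsD)
    moreover have "n = length ?b" using x(2) n m by simp
    ultimately have "?b \<approx> v1" using IH[OF _ rb _ cox_sym[OF \<open>v1 \<sim> ?b\<close>]] by blast
    from braid_trans[OF 1[unfolded b'] braid_Cons[OF this]] show ?thesis unfolding w v .
  qed
qed


section \<open>Cosets of the subgroup generated by two letters\<close>

text \<open>If neither \<open>s\<close> nor \<open>t\<close> is a right descent of \<open>x\<close>, then \<open>x\<close> is the shortest element of its coset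
  modulo the subgroup generated by \<open>s\<close> and \<open>t\<close>, and lengths add up in this coset.\<close>

lemma reduced_pair_cosets:
  assumes "reduced (x @ [s])" "reduced (x @ [t])" "reduced z" "set z \<subseteq> {s, t}"
  shows "reduced (x @ z)"
proof -
  \<comment> \<open>\<open>Q\<close> describes the coset of \<open>x\<close>, and \<open>y\<close> is one of its shortest words; in the end \<open>y\<close> equals \<open>x\<close>\<close>
  define Q where "Q = (\<lambda>y. \<exists>a. x \<sim> y @ a \<and> set a \<subseteq> {s, t})"
  have "Q x" unfolding Q_def by (intro exI[of _ "[]"]) simp
  then obtain y where Qy: "Q y" and ymin: "\<And>y'. Q y' \<Longrightarrow> length y \<le> length y'"
    using ex_has_least_nat[of Q x length] by blast
  have ry: "reduced y"
    unfolding reduced_def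
  proof (intro allI impI)
    fix y' assume "y \<sim> y'"
    then have "Q y'" using Qy unfolding Q_def by (meson cox_append cox_refl cox_trans)
    then show "length y \<le> length y'" by (rule ymin)
  qed
  have yz: "reduced (y @ z)" if "reduced z" "set z \<subseteq> {s, t}" for z
    using that
  proof (induction z rule: rev_induct)
    case (snoc r z)
    have r: "reduced (y @ z)" using snoc reduced_appendD1 by auto
    show ?case
    proof (rule ccontr)
      assume "\<not> reduced (y @ z @ [r])"
      then have "\<not> reduced ((y @ z) @ [r])" by simp
      from exchange_right[OF r this] obtain u1 p u2 where
        e: "y @ z = u1 @ p # u2" and c: "u2 @ [r] \<sim> p # u2" by blast
      have c': "p # u2 @ [r] \<sim> u2"
        using cox_move_left_Cons[of p "u2 @ [r]" u2] c by simp
      consider q where "u1 = y @ q" "z = q @ p # u2" | q where "y = u1 @ p # q" "u2 = q @ z"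
        using e by (auto simp: append_eq_append_conv2 append_eq_Cons_conv)
      then show False
      proof cases
        case 1
        have "z @ [r] \<sim> q @ u2" using cox_append[OF cox_refl c', of q] 1 by simp
        moreover have "length (q @ u2) < length (z @ [r])" using 1 by simp
        ultimately show False using snoc.prems(1) unfolding reduced_def by (meson not_le)
      next
        case 2
        obtain a where a: "x \<sim> y @ a" "set a \<subseteq> {s, t}" using Qy unfolding Q_def by blast
        have "p # q @ (z @ [r]) \<sim> q @ z" using c' 2 by simp
        then have "(p # q) @ (z @ [r]) \<sim> q @ z" by simp
        then have "p # q \<sim> (q @ z) @ rev (z @ [r])"
          using cox_move_right[of "p # q" "z @ [r]" "q @ z"] by blast
        then have "u1 @ (p # q) @ a \<sim> u1 @ ((q @ z) @ rev (z @ [r])) @ a"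
          by (intro cox_append) auto
        then have "x \<sim> (u1 @ q) @ (z @ rev (z @ [r]) @ a)"
          using cox_trans[OF a(1)] 2 by simp
        then have "Q (u1 @ q)" unfolding Q_def
          using a(2) snoc.prems(2) by (intro exI[of _ "z @ rev (z @ [r]) @ a"]) auto
        then show False using ymin[of "u1 @ q"] 2 by simp
      qed
    qed
  qed (simp add: ry)
  obtain a0 where a0: "x \<sim> y @ a0" "set a0 \<subseteq> {s, t}" using Qy unfolding Q_def by blast
  obtain a where a: "a0 \<sim> a" "reduced a" "set a \<subseteq> {s, t}" using ex_reduced[of a0] a0(2) by blast
  have xa: "x \<sim> y @ a" using cox_trans[OF a0(1) cox_append[OF cox_refl a(1)]] .
  have rx: "reduced x" using assms(1) by (rule reduced_appendD1)
  have lx: "length x = length (y @ a)" by (rule reduced_length_eq[OF xa rx yz[OF a(2,3)]])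
  have "a = []"
  proof (rule ccontr)
    assume "a \<noteq> []"
    then obtain b r where b: "a = b @ [r]" by (metis rev_exhaust)
    then have r: "reduced (x @ [r])" using a(3) assms(1,2) by auto
    have "(y @ a) @ [r] \<sim> y @ b"
      using cox_context[OF cox_square, of "y @ b" r "[]" "[]"] b by simp
    then have "x @ [r] \<sim> y @ b" using cox_trans[OF cox_append[OF xa cox_refl]] by blast
    then have "length (x @ [r]) \<le> length (y @ b)" using r unfolding reduced_def by blast
    then show False using lx b by simp
  qed
  then have "y @ z \<sim> x @ z" "length (y @ z) = length (x @ z)"
    using cox_append[OF cox_sym[OF xa] cox_refl, of z] lx by auto
  then show ?thesis using reduced_cong_length yz[OF assms(3,4)] by blast
qed

section \<open>The prefix order\<close>

text \<open>The weak order: \<open>b\<close> has a reduced expression that starts with the reduced word \<open>c\<close>.\<close>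

definition prefix :: "'a list \<Rightarrow> 'a list \<Rightarrow> bool"  (infix "\<preceq>" 50) where
  "c \<preceq> b \<longleftrightarrow> (\<exists>e. c @ e \<sim> b \<and> reduced (c @ e))"

lemma prefix_cong: "c \<sim> c' \<Longrightarrow> reduced c' \<Longrightarrow> b \<sim> b' \<Longrightarrow> c \<preceq> b \<Longrightarrow> c' \<preceq> b'"
proof -
  assume *: "c \<sim> c'" "reduced c'" "b \<sim> b'" "c \<preceq> b"
  then obtain e where e: "c @ e \<sim> b" "reduced (c @ e)" unfolding prefix_def by blast
  have l: "length c = length c'" using reduced_length_eq[OF *(1) reduced_appendD1[OF e(2)] *(2)] .
  have ce: "c @ e \<sim> c' @ e" using *(1) by (rule cox_append) simp
  have "reduced (c' @ e)" by (rule reduced_cong_length[OF ce _ e(2)]) (simp add: l)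
  moreover have "c' @ e \<sim> b'" using cox_trans[OF cox_sym[OF ce] cox_trans[OF e(1) *(3)]] .
  ultimately show "c' \<preceq> b'" unfolding prefix_def by blast
qed

lemma prefix_reduced: "c \<preceq> b \<Longrightarrow> reduced c"
  unfolding prefix_def using reduced_appendD1 by blast

lemma prefix_refl: "reduced c \<Longrightarrow> c \<preceq> c"
  unfolding prefix_def by (intro exI[of _ "[]"]) simp

lemma prefix_cox: "reduced c \<Longrightarrow> c \<sim> d \<Longrightarrow> c \<preceq> d"
  unfolding prefix_def by (intro exI[of _ "[]"]) simp

lemma prefix_trans [trans]:
  assumes "a \<preceq> b" "b \<preceq> c"
  shows "a \<preceq> c"
proof -
  obtain e f where e: "a @ e \<sim> b" "reduced (a @ e)" and f: "b @ f \<sim> c" "reduced (b @ f)"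
    using assms unfolding prefix_def by blast
  have l: "length (a @ e) = length b"
    by (rule reduced_length_eq[OF e reduced_appendD1[OF f(2)]])
  have c: "b @ f \<sim> a @ e @ f" using cox_append[OF cox_sym[OF e(1)] cox_refl, of f] by simp
  have "reduced (a @ e @ f)" by (rule reduced_cong_length[OF c _ f(2)]) (use l in simp)
  moreover have "a @ e @ f \<sim> c" using cox_trans[OF cox_sym[OF c] f(1)] .
  ultimately show ?thesis unfolding prefix_def by blast
qed

lemma prefix_antisym:
  assumes "a \<preceq> b" "b \<preceq> a"
  shows "a \<sim> b"
proof -
  obtain e where e: "a @ e \<sim> b" "reduced (a @ e)" using assms(1) unfolding prefix_def by blast
  obtain f where f: "b @ f \<sim> a" "reduced (b @ f)" using assms(2) unfolding prefix_def by blast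
  have "length (a @ e) = length b" "length (b @ f) = length a"
    using reduced_length_eq[OF e reduced_appendD1[OF f(2)]]
      reduced_length_eq[OF f reduced_appendD1[OF e(2)]] by auto
  then have "length e = 0" unfolding length_append by linarith
  then show ?thesis using e by simp
qed

lemma prefix_append: "reduced (a @ c) \<Longrightarrow> b \<preceq> c \<Longrightarrow> a @ b \<preceq> a @ c"
proof -
  assume *: "reduced (a @ c)" "b \<preceq> c"
  then obtain e where e: "b @ e \<sim> c" "reduced (b @ e)" unfolding prefix_def by blast
  have l: "length (b @ e) = length c" by (rule reduced_length_eq[OF e reduced_appendD2[OF *(1)]])
  have c: "a @ c \<sim> a @ b @ e" using cox_append[OF cox_refl cox_sym[OF e(1)]] by simp
  have "reduced (a @ b @ e)" by (rule reduced_cong_length[OF c _ *(1)]) (use l in simp)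
  then show "a @ b \<preceq> a @ c" unfolding prefix_def
    by (intro exI[of _ e]) (simp add: cox_sym[OF c])
qed

lemma prefix_append_cancel:
  assumes "a @ b \<preceq> a @ c"
  shows "b \<preceq> c"
proof -
  obtain e where e: "(a @ b) @ e \<sim> a @ c" "reduced ((a @ b) @ e)" using assms unfolding prefix_def by blast
  then have "b @ e \<sim> c" "reduced (b @ e)" using cox_cancel_left[of a "b @ e" c] reduced_appendD2[of a "b @ e"] by auto
  then show ?thesis unfolding prefix_def by blast
qed

lemma reduced_prefix: "reduced (a @ c) \<Longrightarrow> b \<preceq> c \<Longrightarrow> reduced (a @ b)"
  using prefix_append prefix_reduced by blast

lemma prefix_length: "c \<preceq> b \<Longrightarrow> reduced b \<Longrightarrow> length c \<le> length b"
  unfolding prefix_def by (metis le_add1 length_append reduced_length_eq)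

lemma prefix_extend:
  assumes "p \<preceq> c" "reduced c" "length p < length c"
  shows "\<exists>s. p @ [s] \<preceq> c"
proof -
  obtain e where e: "p @ e \<sim> c" "reduced (p @ e)" using assms(1) unfolding prefix_def by blast
  have "e \<noteq> []" using reduced_length_eq[OF e assms(2)] assms(3) by auto
  then obtain s f where "e = s # f" by (cases e) auto
  then show ?thesis using e unfolding prefix_def by (intro exI[of _ s] exI[of _ f]) simp
qed

text \<open>If two distinct extensions of \<open>c\<close> by a letter are below \<open>b\<close>, then the two letters have a relation, and
  the extension of \<open>c\<close> by its alternating word is below \<open>b\<close> too.\<close>

lemma prefix_letters:
  assumes "c @ [s] \<preceq> b" "c @ [t] \<preceq> b" "s \<noteq> t"
  shows "m s t \<noteq> 0 \<and> c @ alt s t (m s t) \<preceq> b"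
proof -
  obtain e where e: "c @ s # e \<sim> b" "reduced (c @ s # e)" using assms(1) unfolding prefix_def by auto
  obtain f where f: "c @ t # f \<sim> b" "reduced (c @ t # f)" using assms(2) unfolding prefix_def by auto
  have ef: "c @ s # e \<sim> c @ t # f" using cox_trans[OF e(1) cox_sym[OF f(1)]] .
  have l: "length (s # e) = length (t # f)" using reduced_length_eq[OF ef e(2) f(2)] by simp
  have "s # e \<sim> t # f" using ef unfolding cox_cancel_left .
  then have "\<not> reduced (t # s # e)"
    using reduced_Cons_cong[of "s # e" "t # f" t] l not_reduced_Cons_Cons by simp
  from two_descents[OF reduced_appendD2[OF e(2)] not_reduced_Cons_Cons this assms(3)]
  obtain v where m: "m s t \<noteq> 0" and v: "s # e \<sim> alt s t (m s t) @ v" "length (s # e) = m s t + length v"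
    by auto
  have cv: "c @ s # e \<sim> c @ alt s t (m s t) @ v" using cox_append[OF cox_refl v(1)] by simp
  have "reduced (c @ alt s t (m s t) @ v)"
    by (rule reduced_cong_length[OF cv _ e(2)]) (use v(2) in simp)
  moreover have "c @ alt s t (m s t) @ v \<sim> b" using cox_trans[OF cox_sym[OF cv] e(1)] .
  ultimately show ?thesis using m unfolding prefix_def by (intro conjI exI[of _ v]) auto
qed

text \<open>The prefixes \<open>c\<close> of \<open>b\<close> for which the product of \<open>a\<close> and \<open>c\<close> is length-additive.\<close>

definition head_prefix :: "'a list \<Rightarrow> 'a list \<Rightarrow> 'a list \<Rightarrow> bool" where
  "head_prefix a b c \<longleftrightarrow> reduced (a @ c) \<and> c \<preceq> b"

lemma head_prefix_down: "head_prefix a b c \<Longrightarrow> q \<preceq> c \<Longrightarrow> head_prefix a b q"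
  unfolding head_prefix_def using reduced_prefix prefix_trans by blast

text \<open>Among these prefixes, those above a given one have a greatest element. As the set of these prefixes is closed under passing to
  prefixes and to the local upper bounds given by
  \<open>prefix_letters\<close> and \<open>reduced_pair_cosets\<close>, this is an argument in the style
  of Newman's lemma, by induction on the distance from the length of \<open>b\<close>.\<close>

lemma head_prefix_above:
  assumes "head_prefix a b p" "reduced b"
  shows "\<exists>g. head_prefix a b g \<and> (\<forall>c. head_prefix a b c \<and> p \<preceq> c \<longrightarrow> c \<preceq> g)"
  using assms(1)
proof (induction "length b - length p" arbitrary: p rule: less_induct)
  case less
  have rp: "reduced p" using less.prems prefix_reduced unfolding head_prefix_def by blast
  have rc: "reduced c" if "head_prefix a b c" for c
    using that prefix_reduced unfolding head_prefix_def by blast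
  have pl: "length c \<le> length b" if "head_prefix a b c" for c
    using that prefix_length assms(2) unfolding head_prefix_def by blast
  define A where "A = {s. head_prefix a b (p @ [s])}"
  have up: "\<exists>g. head_prefix a b g \<and> (\<forall>c. head_prefix a b c \<and> p @ u \<preceq> c \<longrightarrow> c \<preceq> g)"
    if "head_prefix a b (p @ u)" "u \<noteq> []" for u
  proof -
    have "length u > 0" "length (p @ u) \<le> length b" using that(2) pl[OF that(1)] by auto
    then have "length b - length (p @ u) < length b - length p" unfolding length_append by linarith
    then show ?thesis using less.hyps[OF _ that(1)] by blast
  qed
  have ext: "\<exists>s\<in>A. p @ [s] \<preceq> c" if "head_prefix a b c" "p \<preceq> c" "\<not> c \<preceq> p" for c
  proof -
    have "length p < length c"
    proof (rule ccontr)
      assume "\<not> length p < length c"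
      obtain e where e: "p @ e \<sim> c" "reduced (p @ e)" using \<open>p \<preceq> c\<close> unfolding prefix_def by blast
      have "length p + length e = length c" using reduced_length_eq[OF e rc[OF that(1)]] by simp
      then have "length e = 0" using \<open>\<not> length p < length c\<close> by linarith
      then have "c \<preceq> p" using e prefix_cox[OF rc[OF that(1)] cox_sym] by simp
      then show False using that(3) by blast
    qed
    from prefix_extend[OF that(2) rc[OF that(1)] this] obtain s where s: "p @ [s] \<preceq> c" by blast
    then show ?thesis using head_prefix_down[OF that(1)] unfolding A_def by blast
  qed
  show ?case
  proof (cases "A = {}")
    case True
    then show ?thesis using ext less.prems by blast
  next
    case False
    then obtain s where s: "s \<in> A" by blast
    then obtain g where g: "head_prefix a b g"
      and gmax: "\<And>c. head_prefix a b c \<Longrightarrow> p @ [s] \<preceq> c \<Longrightarrow> c \<preceq> g"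
      using up[of "[s]"] unfolding A_def by blast
    have sg: "p @ [s] \<preceq> g" using gmax s rc prefix_refl unfolding A_def by blast
    have tg: "p @ [t] \<preceq> g" if t: "t \<in> A" for t
    proof (cases "s = t")
      case True
      then show ?thesis using sg by simp
    next
      case False
      let ?d = "p @ alt s t (m s t)"
      have st: "p @ [s] \<preceq> b" "p @ [t] \<preceq> b" and ra: "reduced ((a @ p) @ [s])" "reduced ((a @ p) @ [t])"
        using s t unfolding A_def head_prefix_def by auto
      have m: "m s t \<noteq> 0" and db: "?d \<preceq> b" using prefix_letters[OF st False] by auto
      have "reduced (alt s t (m s t))" using reduced_alt[OF False] by (simp add: alt_ok_def)
      then have "reduced (a @ ?d)" using reduced_pair_cosets[OF ra _ set_alt] by simp
      then have d: "head_prefix a b ?d" using db unfolding head_prefix_def by blast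
      have "p @ [s] \<preceq> ?d"
        using alt_pred[OF m] rc[OF d] unfolding prefix_def
        by (intro exI[of _ "alt t s (m s t - 1)"]) simp
      then have dg: "?d \<preceq> g" using gmax[OF d] by blast
      have e: "p @ alt t s (m s t) \<sim> ?d"
        using cox_append[OF cox_refl braid_imp_cox[OF braid_rel[OF False m]]] cox_sym by blast
      have "p @ alt t s (m s t) = (p @ [t]) @ alt s t (m s t - 1)"
        using alt_pred[of t s] m m_sym[of s t] by simp
      moreover have "reduced (p @ alt t s (m s t))"
        by (rule reduced_cong_length[OF cox_sym[OF e] _ rc[OF d]]) simp
      ultimately have "p @ [t] \<preceq> ?d" using e unfolding prefix_def by metis
      then show ?thesis using dg prefix_trans by blast
    qed
    have "c \<preceq> g" if c: "head_prefix a b c" "p \<preceq> c" for c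
    proof (cases "c \<preceq> p")
      case True
      have "p \<preceq> p @ [s]" using s rc unfolding A_def prefix_def by blast
      then show ?thesis using True sg prefix_trans by blast
    next
      case False
      then obtain t where t: "t \<in> A" "p @ [t] \<preceq> c" using ext c by blast
      obtain h where h: "head_prefix a b h"
        and hmax: "\<And>c. head_prefix a b c \<Longrightarrow> p @ [t] \<preceq> c \<Longrightarrow> c \<preceq> h"
        using up[of "[t]"] t(1) unfolding A_def by blast
      have "p @ [t] \<preceq> h" using hmax t(1) rc prefix_refl unfolding A_def by blast
      have gh: "g \<preceq> h" using hmax[OF g tg[OF t(1)]] .
      have "p @ [s] \<preceq> h" using sg gh prefix_trans by blast
      then have "h \<preceq> g" using gmax[OF h] by blast
      moreover have "c \<preceq> h" using hmax[OF c(1) t(2)] .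
      ultimately show ?thesis using prefix_trans by blast
    qed
    then show ?thesis using g by blast
  qed
qed

text \<open>A chosen reduced word for each element, so that equality in the Coxeter group becomes equality of
  words.\<close>

definition canon :: "'a list \<Rightarrow> 'a list" where
  "canon u = (SOME v. u \<sim> v \<and> reduced v)"

lemma canon_cox: "u \<sim> canon u" and reduced_canon [simp]: "reduced (canon u)"
  using someI_ex[of "\<lambda>v. u \<sim> v \<and> reduced v"] ex_reduced[of u] unfolding canon_def by auto

lemma cox_eq_iff: "u \<sim> v \<Longrightarrow> (u \<sim> w) = (v \<sim> w)"
  using cox_trans[of u v w] cox_trans[of v u w] cox_sym by blast

lemma canon_eq_iff: "canon u = canon v \<longleftrightarrow> u \<sim> v"
proof
  assume "canon u = canon v"
  then show "u \<sim> v" using cox_trans[OF canon_cox[of u]] cox_sym[OF canon_cox[of v]] by simp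
next
  assume "u \<sim> v"
  then have "(\<lambda>w. u \<sim> w \<and> reduced w) = (\<lambda>w. v \<sim> w \<and> reduced w)" by (simp only: cox_eq_iff[OF \<open>u \<sim> v\<close>])
  then show "canon u = canon v" unfolding canon_def by simp
qed

lemma canon_canon [simp]: "canon (canon u) = canon u"
  unfolding canon_eq_iff by (rule cox_sym[OF canon_cox])

lemma canon_braid: "reduced u \<Longrightarrow> u \<approx> canon u"
  by (rule matsumoto[OF _ reduced_canon canon_cox])

text \<open>The greatest prefix of \<open>b\<close> that can be moved to \<open>a\<close> with the lengths adding up.\<close>

definition head :: "'a list \<Rightarrow> 'a list \<Rightarrow> 'a list" where
  "head a b = canon (SOME c. head_prefix a b c \<and> (\<forall>d. head_prefix a b d \<longrightarrow> d \<preceq> c))"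

lemma head_prefix_cong1: "c \<sim> c' \<Longrightarrow> reduced c' \<Longrightarrow> head_prefix a b c \<Longrightarrow> head_prefix a b c'"
proof -
  assume *: "c \<sim> c'" "reduced c'" "head_prefix a b c"
  then have 1: "reduced (a @ c)" "c \<preceq> b" unfolding head_prefix_def by auto
  have "length c = length c'" using reduced_length_eq[OF *(1) prefix_reduced[OF 1(2)] *(2)] .
  then have "reduced (a @ c')" using reduced_cong_length[OF cox_append[OF cox_refl *(1)] _ 1(1)] by simp
  moreover have "c' \<preceq> b" using prefix_cong[OF *(1,2) cox_refl 1(2)] .
  ultimately show "head_prefix a b c'" unfolding head_prefix_def by blast
qed

lemma head_prefix_cong2:
  assumes "a \<sim> a'" "reduced a'" "b \<sim> b'" "head_prefix a b c"
  shows "head_prefix a' b' c"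
proof -
  have 1: "reduced (a @ c)" "c \<preceq> b" using assms(4) unfolding head_prefix_def by auto
  have "length a = length a'" using reduced_length_eq[OF assms(1) reduced_appendD1[OF 1(1)] assms(2)] .
  then have "reduced (a' @ c)" using reduced_cong_length[OF cox_append[OF assms(1) cox_refl] _ 1(1)] by simp
  moreover have "c \<preceq> b'" using prefix_cong[OF cox_refl prefix_reduced[OF 1(2)] assms(3) 1(2)] .
  ultimately show ?thesis unfolding head_prefix_def by blast
qed

lemma head_greatest:
  assumes "reduced a" "reduced b"
  shows "head_prefix a b (head a b)" and "head_prefix a b d \<Longrightarrow> d \<preceq> head a b"
proof -
  have "head_prefix a b []" using assms unfolding head_prefix_def prefix_def
    by (intro conjI exI[of _ b]) auto
  from head_prefix_above[OF this assms(2)]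
  obtain g where g: "head_prefix a b g" "\<And>c. head_prefix a b c \<Longrightarrow> [] \<preceq> c \<Longrightarrow> c \<preceq> g" by blast
  have "[] \<preceq> c" if "head_prefix a b c" for c
    using that prefix_reduced unfolding head_prefix_def prefix_def by (metis append_Nil cox_refl)
  then have "\<exists>c. head_prefix a b c \<and> (\<forall>d. head_prefix a b d \<longrightarrow> d \<preceq> c)" using g by blast
  from someI_ex[OF this] obtain c where c: "head a b = canon c" "head_prefix a b c"
    "\<And>d. head_prefix a b d \<Longrightarrow> d \<preceq> c" unfolding head_def by blast
  show "head_prefix a b (head a b)"
    unfolding c(1) using head_prefix_cong1[OF canon_cox reduced_canon c(2)] .
  have "c \<preceq> canon c" using prefix_cox[OF _ canon_cox] c(2) prefix_reduced unfolding head_prefix_def by blast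
  then show "head_prefix a b d \<Longrightarrow> d \<preceq> head a b"
    unfolding c(1) using c(3) prefix_trans by blast
qed

lemma head_cong:
  assumes "a \<sim> a'" "reduced a" "reduced a'" "b \<sim> b'"
  shows "head a b = head a' b'"
proof -
  have "head_prefix a b = head_prefix a' b'"
    using head_prefix_cong2[OF assms(1,3,4)] head_prefix_cong2[OF cox_sym[OF assms(1)] assms(2) cox_sym[OF assms(4)]]
    by (intro ext) blast
  then show ?thesis unfolding head_def by simp
qed

lemma head_eqI:
  assumes "reduced a" "reduced b" "head_prefix a b c" "\<And>d. head_prefix a b d \<Longrightarrow> d \<preceq> c"
  shows "head a b = canon c"
proof -
  have "head a b \<sim> c"
    using prefix_antisym head_greatest[OF assms(1,2)] assms(3,4) by blast
  then have "canon (head a b) = canon c" unfolding canon_eq_iff .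
  then show ?thesis unfolding head_def by simp
qed


section \<open>Normal forms\<close>

text \<open>What remains of \<open>b\<close> once its head has been moved to \<open>a\<close>.\<close>

definition rest :: "'a list \<Rightarrow> 'a list \<Rightarrow> 'a list" where
  "rest a b = canon (rev (head a b) @ b)"

lemma reduced_rest [simp]: "reduced (rest a b)"
  by (simp add: rest_def)

lemma reduced_head [simp]: "reduced (head a b)"
  by (simp add: head_def)

lemma head_rest:
  assumes "reduced a" "reduced b"
  shows "reduced (a @ head a b)" "head a b @ rest a b \<sim> b" "reduced (head a b @ rest a b)"
    and "head a b @ rest a b \<approx> b"
proof -
  note h = head_greatest(1)[OF assms, unfolded head_prefix_def]
  show "reduced (a @ head a b)" using h by blast
  show c: "head a b @ rest a b \<sim> b"
    unfolding rest_def cox_move_left by (rule cox_sym[OF canon_cox])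
  obtain e where e: "head a b @ e \<sim> b" "reduced (head a b @ e)" using h unfolding prefix_def by blast
  have "head a b @ e \<sim> head a b @ rest a b" using cox_trans[OF e(1) cox_sym[OF c]] .
  then have "e \<sim> rest a b" unfolding cox_cancel_left .
  from reduced_length_eq[OF this reduced_appendD2[OF e(2)] reduced_rest]
  show r: "reduced (head a b @ rest a b)"
    using reduced_cong_length[OF \<open>head a b @ e \<sim> head a b @ rest a b\<close> _ e(2)] by simp
  show "head a b @ rest a b \<approx> b" by (rule matsumoto[OF r assms(2) c])
qed

text \<open>Left multiplication by a reduced word \<open>a\<close> on sequences of reduced words. A sequence stands for the
  product of its entries, and is infinite, with empty entries from some index on, so that no case
  distinction on its length is needed: the head of the first entry moves to \<open>a\<close>,
  which yields the new first entry, and the rest of it acts on the tail of the sequence.\<close>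

fun act :: "'a list \<Rightarrow> (nat \<Rightarrow> 'a list) \<Rightarrow> nat \<Rightarrow> 'a list" where
  "act a x 0 = canon (a @ head a (x 0))"
| "act a x (Suc n) = act (rest a (x 0)) (x \<circ> Suc) n"

lemma act_comp_Suc: "act a x \<circ> Suc = act (rest a (x 0)) (x \<circ> Suc)"
  by auto

lemma reduced_act [simp]: "reduced (act a x n)"
  by (induction n arbitrary: a x) auto

lemma act_cong:
  assumes "a \<sim> b" "reduced a" "reduced b"
  shows "act a x n = act b x n"
proof -
  have h: "head a (x 0) = head b (x 0)" by (rule head_cong[OF assms cox_refl])
  then have "rest a (x 0) = rest b (x 0)" by (simp add: rest_def)
  moreover have "canon (a @ head a (x 0)) = canon (b @ head b (x 0))"
    unfolding h canon_eq_iff by (rule cox_append[OF assms(1) cox_refl])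
  ultimately show ?thesis by (cases n) auto
qed

text \<open>Moving letters to \<open>b\<close> and then to \<open>a\<close> moves as much as moving them to the product at once.\<close>

lemma head_product:
  assumes "reduced (a @ b)" "reduced x"
  shows "head a (b @ head b x) \<sim> b @ head (a @ b) x"
proof -
  let ?c = "head b x" and ?e = "head (a @ b) x"
  have rb: "reduced b" and ra: "reduced a"
    using assms(1) reduced_appendD1 reduced_appendD2 by blast+
  have bc: "reduced (b @ ?c)" using head_rest(1)[OF rb assms(2)] .
  have e: "reduced ((a @ b) @ ?e)" "?e \<preceq> x"
    using head_greatest(1)[OF assms] unfolding head_prefix_def by auto
  have "head_prefix b x ?e"
    using e reduced_appendD2[of a "b @ ?e"] unfolding head_prefix_def by simp
  then have "?e \<preceq> ?c" by (rule head_greatest(2)[OF rb assms(2)])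
  then have 1: "head_prefix a (b @ ?c) (b @ ?e)"
    using e(1) prefix_append[OF bc] unfolding head_prefix_def by simp
  have "d \<preceq> b @ ?e" if d: "head_prefix a (b @ ?c) d" for d
  proof -
    let ?g = "head a (b @ ?c)"
    have g: "head_prefix a (b @ ?c) ?g" by (rule head_greatest(1)[OF ra bc])
    have "b \<preceq> b @ ?c" unfolding prefix_def using bc cox_refl by blast
    then have "head_prefix a (b @ ?c) b" using assms(1) unfolding head_prefix_def by blast
    then have "b \<preceq> ?g" by (rule head_greatest(2)[OF ra bc])
    then obtain f where f: "b @ f \<sim> ?g" "reduced (b @ f)" unfolding prefix_def by blast
    have "head_prefix a (b @ ?c) (b @ f)"
      by (rule head_prefix_cong1[OF cox_sym[OF f(1)] f(2) g])
    then have f': "reduced ((a @ b) @ f)" "b @ f \<preceq> b @ ?c" unfolding head_prefix_def by auto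
    have "?c \<preceq> x" using head_greatest(1)[OF rb assms(2)] unfolding head_prefix_def by blast
    then have "f \<preceq> x" using prefix_append_cancel[OF f'(2)] prefix_trans by blast
    then have "head_prefix (a @ b) x f" using f'(1) unfolding head_prefix_def by blast
    then have "f \<preceq> ?e" by (rule head_greatest(2)[OF assms])
    then have "b @ f \<preceq> b @ ?e" using prefix_append e(1) reduced_appendD2[of a "b @ ?e"] by simp
    moreover have "?g \<preceq> b @ f" by (rule prefix_cox[OF reduced_head cox_sym[OF f(1)]])
    moreover have "d \<preceq> ?g" by (rule head_greatest(2)[OF ra bc d])
    ultimately show ?thesis using prefix_trans by blast
  qed
  then have "head a (b @ ?c) = canon (b @ ?e)" by (rule head_eqI[OF ra bc 1])
  then show ?thesis using cox_sym[OF canon_cox] by simp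
qed

text \<open>Hence \<open>act\<close> is an action as far as lengths add up, which includes both sides of a braid relation.\<close>

theorem act_act:
  assumes "reduced (a @ b)" "\<And>i. reduced (x i)"
  shows "act a (act b x) n = act (a @ b) x n"
  using assms
proof (induction n arbitrary: a b x)
  case 0
  have ra: "reduced a" using reduced_appendD1 "0.prems"(1) by blast
  have "head a (act b x 0) = head a (b @ head b (x 0))"
    unfolding act.simps by (rule head_cong[OF cox_refl ra ra cox_sym[OF canon_cox]])
  then have "head a (act b x 0) \<sim> b @ head (a @ b) (x 0)" using head_product[OF 0] by simp
  then have "a @ head a (act b x 0) \<sim> a @ b @ head (a @ b) (x 0)" unfolding cox_cancel_left .
  then show ?case using canon_eq_iff by simp
next
  case (Suc n)
  let ?c = "head b (x 0)" and ?e = "head (a @ b) (x 0)"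
  have ra: "reduced a" and rb: "reduced b" using reduced_appendD1 reduced_appendD2 Suc.prems(1) by blast+
  note x0 = Suc.prems(2)[of 0]
  have bc: "reduced (b @ ?c)" using head_rest(1)[OF rb x0] .
  have h: "head a (act b x 0) = head a (b @ ?c)"
    unfolding act.simps by (rule head_cong[OF cox_refl ra ra cox_sym[OF canon_cox]])
  \<comment> \<open>the two heads satisfy \<open>?e \<preceq> ?c\<close>; let \<open>g\<close> be the quotient\<close>
  have "head_prefix b (x 0) ?e"
    using head_greatest(1)[OF Suc.prems(1) x0] reduced_appendD2[of a "b @ ?e"]
    unfolding head_prefix_def by simp
  then have "?e \<preceq> ?c" by (rule head_greatest(2)[OF rb x0])
  then obtain g where g: "?e @ g \<sim> ?c" "reduced (?e @ g)" unfolding prefix_def by blast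
  have rg: "reduced g" using reduced_appendD2[OF g(2)] .
  have "head a (act b x 0) @ g \<sim> (b @ ?e) @ g"
    using head_product[OF Suc.prems(1) x0] unfolding h by (rule cox_append) simp
  also have "(b @ ?e) @ g \<sim> b @ ?c" using cox_append[OF cox_refl g(1)] by simp
  also have "b @ ?c \<sim> act b x 0" unfolding act.simps by (rule canon_cox)
  finally have "g \<sim> rev (head a (act b x 0)) @ act b x 0" unfolding cox_move_left .
  then have A: "rest a (act b x 0) \<sim> g"
    unfolding rest_def using cox_trans[OF _ canon_cox] cox_sym by blast
  have cx: "(?e @ g) @ rest b (x 0) \<sim> ?c @ rest b (x 0)"
    using g(1) by (rule cox_append) simp
  have lc: "length (?e @ g) = length ?c" using reduced_length_eq[OF g reduced_head] .
  have "reduced ((?e @ g) @ rest b (x 0))"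
    by (rule reduced_cong_length[OF cox_sym[OF cx] _ head_rest(3)[OF rb x0]]) (use lc in simp)
  then have rgr: "reduced (g @ rest b (x 0))" using reduced_appendD2[of ?e] by simp
  have "?e @ g @ rest b (x 0) \<sim> x 0"
    using cox_trans[OF cx head_rest(2)[OF rb x0]] by simp
  then have "g @ rest b (x 0) \<sim> rev ?e @ x 0" unfolding cox_move_left .
  then have B: "g @ rest b (x 0) \<sim> rest (a @ b) (x 0)"
    unfolding rest_def[of "a @ b"] using cox_trans[OF _ canon_cox] by blast
  have "act a (act b x) (Suc n) = act (rest a (act b x 0)) (act (rest b (x 0)) (x \<circ> Suc)) n"
    by (simp add: act_comp_Suc del: act.simps(1))
  also have "\<dots> = act g (act (rest b (x 0)) (x \<circ> Suc)) n"
    by (rule act_cong[OF A reduced_rest rg])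
  also have "\<dots> = act (g @ rest b (x 0)) (x \<circ> Suc) n"
    by (rule Suc.IH[OF rgr]) (simp add: Suc.prems(2))
  also have "\<dots> = act (rest (a @ b) (x 0)) (x \<circ> Suc) n"
    by (rule act_cong[OF B rgr reduced_rest])
  finally show ?case by simp
qed

text \<open>The normal form of a positive word: its letters act successively on the trivial sequence.\<close>

fun normal_form :: "'a list \<Rightarrow> nat \<Rightarrow> 'a list" where
  "normal_form [] n = []"
| "normal_form (s # u) n = act [s] (normal_form u) n"

lemma reduced_normal_form [simp]: "reduced (normal_form u n)"
  by (cases u) auto

lemma normal_form_Cons: "normal_form (s # u) = act [s] (normal_form u)"
  by auto

lemma normal_form_reduced_append:
  assumes "reduced u" "u \<noteq> []"
  shows "normal_form (u @ w) = act u (normal_form w)"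
  using assms
proof (induction u)
  case (Cons s u)
  show ?case
  proof (cases "u = []")
    case False
    then have "normal_form (u @ w) = act u (normal_form w)"
      using Cons reduced_ConsD by blast
    then have "normal_form ((s # u) @ w) = act [s] (act u (normal_form w))"
      using normal_form_Cons[of s "u @ w"] by simp
    also have "\<dots> = act (s # u) (normal_form w)"
      using act_act[of "[s]" u "normal_form w"] Cons.prems(1) by (intro ext) simp
    finally show ?thesis .
  qed (simp add: normal_form_Cons)
qed simp

lemma normal_form_append_cong:
  "normal_form u = normal_form v \<Longrightarrow> normal_form (x @ u) = normal_form (x @ v)"
  by (induction x) (simp_all only: append.simps normal_form_Cons)

lemma normal_form_alt:
  assumes "s \<noteq> t" "m s t \<noteq> 0"
  shows "normal_form (alt s t (m s t) @ y) = act (alt s t (m s t)) (normal_form y)"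
proof (rule normal_form_reduced_append)
  show "reduced (alt s t (m s t))" by (rule reduced_alt[OF assms(1)]) (simp add: alt_ok_def)
  show "alt s t (m s t) \<noteq> []" using alt_pred[OF assms(2)] by simp
qed

lemma normal_form_braid_step:
  assumes "braid_step u v"
  shows "normal_form u = normal_form v"
proof -
  obtain x y s t where b: "s \<noteq> t" "m s t \<noteq> 0" "u = x @ alt s t (m s t) @ y"
    "v = x @ alt t s (m s t) @ y" using assms unfolding braid_step_def by blast
  have b': "m t s \<noteq> 0" using b(2) unfolding m_sym[of t s] .
  have "normal_form (alt s t (m s t) @ y) = act (alt s t (m s t)) (normal_form y)"
    by (rule normal_form_alt[OF b(1,2)])
  also have "\<dots> = act (alt t s (m s t)) (normal_form y)"
  proof (rule ext, rule act_cong)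
    show "alt s t (m s t) \<sim> alt t s (m s t)" by (rule braid_imp_cox[OF braid_rel[OF b(1,2)]])
    show "reduced (alt s t (m s t))" by (rule reduced_alt[OF b(1)]) (simp add: alt_ok_def)
    show "reduced (alt t s (m s t))"
      by (rule reduced_alt[OF b(1)[symmetric]]) (simp add: alt_ok_def m_sym[of t s])
  qed
  also have "\<dots> = normal_form (alt t s (m s t) @ y)"
    using normal_form_alt[OF b(1)[symmetric] b', of y] unfolding m_sym[of t s] by (rule HOL.sym)
  finally show ?thesis unfolding b(3,4) by (rule normal_form_append_cong)
qed

text \<open>The normal form is an invariant of the element of the monoid; conversely, the next lemmas recover
  the element as the product of the entries.\<close>

theorem normal_form_cong: "u \<approx> v \<Longrightarrow> normal_form u = normal_form v"
  unfolding braid_eq_def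
proof (induction rule: rtranclp_induct)
  case (step v w)
  then show ?case using normal_form_braid_step[of v w] by simp
qed simp

lemma head_rest_Nil: "reduced a \<Longrightarrow> head a [] = [] \<and> rest a [] = []"
proof -
  assume a: "reduced a"
  have "length (head a [] @ rest a []) = length ([] :: 'a list)"
    by (rule reduced_length_eq[OF head_rest(2,3)[OF a reduced_Nil] reduced_Nil])
  then show ?thesis by simp
qed

lemma concat_act:
  assumes "reduced a" "\<And>i. reduced (x i)" "\<And>i. i \<ge> N \<Longrightarrow> x i = []"
  shows "a @ concat (map x [0..<N]) \<approx> concat (map (act a x) [0..<Suc N])"
    and "i \<ge> Suc N \<Longrightarrow> act a x i = []"
  using assms
proof (induction N arbitrary: a x i)
  case 0
  {
    case 1
    then show ?case using head_rest_Nil[OF "1"(1)] canon_braid by simp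
  next
    case 2
    have "canon [] = []" using braid_length[OF canon_braid[OF reduced_Nil]] by simp
    then have "act [] (\<lambda>_. []) j = []" for j
      using head_rest_Nil[OF reduced_Nil] by (induction j) (simp_all add: o_def)
    moreover have "x = (\<lambda>_. [])" using 2 by auto
    ultimately show ?case using 2 head_rest_Nil[OF "2"(2)] by (cases i) (auto simp: o_def)
  }
next
  case (Suc N)
  {
    case 1
    have "a @ concat (map x [0..<Suc N]) = a @ x 0 @ concat (map (x \<circ> Suc) [0..<N])"
      by (simp add: upt_conv_Cons map_Suc_upt[symmetric] del: upt_Suc)
    also have "\<dots> \<approx> a @ (head a (x 0) @ rest a (x 0)) @ concat (map (x \<circ> Suc) [0..<N])"
      using 1 by (intro braid_append braid_refl braid_sym[OF head_rest(4)])
    also have "\<dots> = (a @ head a (x 0)) @ (rest a (x 0) @ concat (map (x \<circ> Suc) [0..<N]))" by simp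
    also have "\<dots> \<approx> act a x 0 @ concat (map (act (rest a (x 0)) (x \<circ> Suc)) [0..<Suc N])"
      using 1 unfolding act.simps
      by (intro braid_append canon_braid head_rest(1) Suc.IH(1)) auto
    also have "\<dots> = concat (map (act a x) [0..<Suc (Suc N)])"
      unfolding act_comp_Suc[symmetric]
      by (simp add: upt_conv_Cons map_Suc_upt[symmetric] comp_assoc del: upt_Suc act.simps)
    finally show ?case .
  next
    case 2
    then obtain j where "i = Suc j" "j \<ge> Suc N" by (cases i) auto
    then show ?case using Suc.IH(2)[of j "rest a (x 0)" "x \<circ> Suc"] 2 by (simp add: o_def)
  }
qed

lemma concat_normal_form:
  "u \<approx> concat (map (normal_form u) [0..<length u]) \<and> (\<forall>i\<ge>length u. normal_form u i = [])"
proof (induction u)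
  case (Cons s u)
  have 1: "[s] @ concat (map (normal_form u) [0..<length u]) \<approx> concat (map (normal_form (s # u)) [0..<length (s # u)])"
    using concat_act(1)[of "[s]" "normal_form u" "length u"] Cons reduced_letter
    unfolding normal_form_Cons by simp
  have "s # u \<approx> [s] @ concat (map (normal_form u) [0..<length u])"
    using Cons braid_Cons by simp
  then show ?case using braid_trans[OF _ 1] Cons concat_act(2)[of "[s]" "normal_form u" "length u"] reduced_letter
    unfolding normal_form_Cons by auto
qed simp

section \<open>Cancellation and common multiples in the monoid\<close>

text \<open>The quotient of \<open>s # u\<close> by \<open>s\<close>, read off from the normal form.\<close>

lemma quotient_normal_form:
  "u \<approx> head [s] (normal_form u 0) @ concat (map (normal_form (s # u) \<circ> Suc) [0..<length u])"
proof (cases u)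
  case Nil
  then show ?thesis using head_rest_Nil[OF reduced_letter[of s]] by simp
next
  case (Cons t w)
  define N where "N = length w"
  let ?x = "normal_form u" and ?y = "normal_form u \<circ> Suc"
  have lu: "length u = Suc N" unfolding N_def Cons by simp
  have "u \<approx> concat (map ?x [0..<Suc N])" using concat_normal_form[of u] lu by simp
  also have "\<dots> = ?x 0 @ concat (map ?y [0..<N])"
    by (simp add: upt_conv_Cons map_Suc_upt[symmetric] del: upt_Suc)
  also have "\<dots> \<approx> (head [s] (?x 0) @ rest [s] (?x 0)) @ concat (map ?y [0..<N])"
    by (intro braid_append braid_refl braid_sym[OF head_rest(4)] reduced_letter reduced_normal_form)
  also have "\<dots> = head [s] (?x 0) @ (rest [s] (?x 0) @ concat (map ?y [0..<N]))" by simp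
  also have "\<dots> \<approx> head [s] (?x 0) @ concat (map (act (rest [s] (?x 0)) ?y) [0..<Suc N])"
    using concat_normal_form[of u] lu by (intro braid_append braid_refl concat_act(1)) auto
  also have "act (rest [s] (?x 0)) ?y = normal_form (s # u) \<circ> Suc"
    unfolding normal_form_Cons act_comp_Suc ..
  finally show ?thesis unfolding lu .
qed

text \<open>By the previous lemma \<open>u\<close> is determined by \<open>s\<close> and by the normal form of \<open>s # u\<close>, since the first entry
  of this normal form is the product of \<open>s\<close> and the head.\<close>

theorem braid_cancel_left_Cons: "s # u \<approx> s # v \<Longrightarrow> u \<approx> v"
proof -
  assume uv: "s # u \<approx> s # v"
  then have nf: "normal_form (s # u) = normal_form (s # v)" by (rule normal_form_cong)
  have len: "length u = length v" using braid_length[OF uv] by simp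
  have "canon ([s] @ head [s] (normal_form u 0)) = canon ([s] @ head [s] (normal_form v 0))"
    using fun_cong[OF nf, of 0] unfolding normal_form_Cons by simp
  then have "head [s] (normal_form u 0) \<sim> head [s] (normal_form v 0)"
    unfolding canon_eq_iff cox_cancel_left .
  then have "head [s] (normal_form u 0) = head [s] (normal_form v 0)"
    unfolding canon_eq_iff[symmetric] by (simp add: head_def)
  then show ?thesis
    using quotient_normal_form[of u s] quotient_normal_form[of v s] nf len braid_sym braid_trans
    by metis
qed

lemma braid_cancel_left: "x @ u \<approx> x @ v \<Longrightarrow> u \<approx> v"
  by (induction x) (auto dest: braid_cancel_left_Cons)

text \<open>A common right multiple of two distinct generators is a right multiple of the common value of the two
  sides of their relation, and in particular there is such a relation. The first entry of the normal form
  has both generators as left descents, so it starts with the alternating word.\<close>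

theorem braid_common_multiple:
  assumes "s # u \<approx> t # v" "s \<noteq> t"
  shows "m s t \<noteq> 0 \<and> (\<exists>z. u \<approx> alt t s (m s t - 1) @ z \<and> v \<approx> alt s t (m s t - 1) @ z)"
proof -
  let ?c = "head [s] (normal_form u 0)" and ?d = "head [t] (normal_form v 0)"
  have nf: "normal_form (s # u) = normal_form (t # v)" by (rule normal_form_cong[OF assms(1)])
  have len: "length u = length v" using braid_length[OF assms(1)] by simp
  have "canon ([s] @ ?c) = canon ([t] @ ?d)"
    using fun_cong[OF nf, of 0] unfolding normal_form_Cons by simp
  then have cd: "s # ?c \<sim> t # ?d" unfolding canon_eq_iff by simp
  have rc: "reduced (s # ?c)" and rd: "reduced (t # ?d)"
    using head_rest(1)[OF reduced_letter reduced_normal_form] by force+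
  have "length ?c = length ?d" using reduced_length_eq[OF cd rc rd] by simp
  then have "\<not> reduced (t # s # ?c)"
    using reduced_Cons_cong[OF cd, of t] not_reduced_Cons_Cons by simp
  from two_descents[OF rc not_reduced_Cons_Cons this assms(2)]
  obtain w where m: "m s t \<noteq> 0" and w: "s # ?c \<sim> alt s t (m s t) @ w"
    "length (s # ?c) = m s t + length w" by auto
  have "s # ?c \<approx> alt s t (m s t) @ w"
    by (rule matsumoto[OF rc reduced_cong_length[OF w(1) _ rc] w(1)]) (use w(2) in simp)
  then have "s # ?c \<approx> s # alt t s (m s t - 1) @ w" using alt_pred[OF m] by simp
  then have c: "?c \<approx> alt t s (m s t - 1) @ w" by (rule braid_cancel_left_Cons)
  have "t # ?d \<approx> s # ?c" by (rule matsumoto[OF rd rc cox_sym[OF cd]])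
  also have "s # ?c \<approx> alt s t (m s t) @ w" by fact
  also have "\<dots> \<approx> alt t s (m s t) @ w" by (intro braid_append braid_rel assms(2) m braid_refl)
  finally have "t # ?d \<approx> t # alt s t (m s t - 1) @ w" using alt_pred[of t s] m m_sym[of s t] by simp
  then have d: "?d \<approx> alt s t (m s t - 1) @ w" by (rule braid_cancel_left_Cons)
  let ?r = "concat (map (normal_form (s # u) \<circ> Suc) [0..<length u])"
  have "u \<approx> ?c @ ?r" by (rule quotient_normal_form)
  also have "\<dots> \<approx> (alt t s (m s t - 1) @ w) @ ?r" by (intro braid_append c braid_refl)
  finally have 1: "u \<approx> alt t s (m s t - 1) @ w @ ?r" by simp
  have "v \<approx> ?d @ ?r" using quotient_normal_form[of v t] unfolding nf len .
  also have "\<dots> \<approx> (alt s t (m s t - 1) @ w) @ ?r" by (intro braid_append d braid_refl)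
  finally have 2: "v \<approx> alt s t (m s t - 1) @ w @ ?r" by simp
  show ?thesis using m 1 2 by blast
qed

end


section \<open>The Garside element of a finite Coxeter group\<close>

text \<open>The subgroup generated by \<open>S\<close> is finite.\<close>

locale finite_coxeter = coxeter_matrix m for m :: "'a \<Rightarrow> 'a \<Rightarrow> nat" +
  fixes S :: "'a set"
  assumes finite_classes: "finite (canon ` {u. set u \<subseteq> S})"
begin

lemma ex_longest:
  "\<exists>d. set d \<subseteq> S \<and> reduced d \<and> (\<forall>u. set u \<subseteq> S \<longrightarrow> reduced u \<longrightarrow> length u \<le> length d)"
proof -
  define L where "L = length ` {u. set u \<subseteq> S \<and> reduced u}"
  have L: "L \<subseteq> length ` canon ` {u. set u \<subseteq> S}"
  proof
    fix n assume "n \<in> L"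
    then obtain u where u: "set u \<subseteq> S" "reduced u" "n = length u" unfolding L_def by blast
    have "n = length (canon u)"
      unfolding u(3) by (rule reduced_length_eq[OF canon_cox u(2) reduced_canon])
    then show "n \<in> length ` canon ` {u. set u \<subseteq> S}" using u(1) by blast
  qed
  have fin: "finite L" by (rule finite_subset[OF L]) (intro finite_imageI finite_classes)
  have "length ([] :: 'a list) \<in> L" unfolding L_def by (rule imageI) simp
  then have "L \<noteq> {}" by blast
  from Max_in[OF fin this] obtain d where d: "set d \<subseteq> S" "reduced d" "Max L = length d"
    by (subst (asm) (2) L_def) auto
  have "length u \<le> length d" if "set u \<subseteq> S" "reduced u" for u
    unfolding d(3)[symmetric] by (rule Max_ge[OF fin]) (use that in \<open>simp add: L_def\<close>)
  then show ?thesis using d(1,2) by blast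
qed

text \<open>A longest reduced word in the letters of \<open>S\<close>.\<close>

definition longest :: "'a list" where
  "longest = (SOME d. set d \<subseteq> S \<and> reduced d \<and> (\<forall>u. set u \<subseteq> S \<longrightarrow> reduced u \<longrightarrow> length u \<le> length d))"

lemma longest_set: "set longest \<subseteq> S"
  and reduced_longest: "reduced longest"
  and longest_max: "set u \<subseteq> S \<Longrightarrow> reduced u \<Longrightarrow> length u \<le> length longest"
  using someI_ex[OF ex_longest, folded longest_def] by auto

text \<open>Every reduced word in the letters of \<open>S\<close> extends to an expression of the longest element. Its letters are put in front
  one after the other by the exchange property, which never deletes a letter placed before.\<close>

lemma longest_extend:
  assumes "set u \<subseteq> S" "reduced u"
  shows "\<exists>v. set v \<subseteq> S \<and> u @ v \<sim> longest \<and> length u + length v = length longest"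
  using assms
proof (induction u)
  case Nil
  then show ?case using longest_set by (intro exI[of _ longest]) auto
next
  case (Cons s u)
  have "set u \<subseteq> S" "reduced u" using Cons.prems reduced_ConsD[OF Cons.prems(2)] by auto
  then obtain v where v: "set v \<subseteq> S" "u @ v \<sim> longest" "length u + length v = length longest"
    using Cons.IH by blast
  have r: "reduced (u @ v)"
    by (rule reduced_cong_length[OF cox_sym[OF v(2)] _ reduced_longest]) (simp add: v(3))
  have "set (s # u @ v) \<subseteq> S" using Cons.prems(1) v(1) by auto
  then have n: "\<not> reduced (s # u @ v)" using longest_max[of "s # u @ v"] v(3) by auto
  from exchange_past_prefix[OF r n Cons.prems(2)] obtain v' where
    v': "u @ v \<sim> s # u @ v'" "length v = Suc (length v')" "set v' \<subseteq> set v" by blast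
  have "(s # u) @ v' \<sim> longest" using cox_trans[OF cox_sym[OF v'(1)] v(2)] by simp
  moreover have "set v' \<subseteq> S" using v(1) v'(3) by auto
  ultimately show ?case using v(3) v'(2) by (intro exI[of _ v']) auto
qed

lemma longest_involution: "longest @ longest \<sim> []"
proof -
  have "set (rev longest) \<subseteq> S" "reduced (rev longest)"
    using longest_set reduced_longest by (simp_all add: reduced_rev)
  from longest_extend[OF this] obtain v where "rev longest @ v \<sim> longest" "length v = 0" by auto
  then have "rev longest \<sim> longest" by simp
  then have "longest @ longest \<sim> longest @ rev longest" by (rule cox_append[OF cox_refl cox_sym])
  also have "longest @ rev longest \<sim> []" using cox_cancel_rev[of longest "[]"] by simp
  finally show ?thesis .
qed

lemma longest_conjugate:
  assumes "s \<in> S"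
  shows "\<exists>t\<in>S. \<exists>x. set x \<subseteq> S \<and> s # x \<approx> longest \<and> x @ [t] \<approx> longest"
proof -
  obtain x where x: "set x \<subseteq> S" "s # x \<sim> longest" "Suc (length x) = length longest"
    using longest_extend[of "[s]"] assms reduced_letter by auto
  have r: "reduced (s # x)"
    by (rule reduced_cong_length[OF cox_sym[OF x(2)] _ reduced_longest]) (simp add: x(3))
  obtain v where v: "set v \<subseteq> S" "x @ v \<sim> longest" "length x + length v = length longest"
    using longest_extend[OF x(1) reduced_ConsD[OF r]] by blast
  then have "length v = 1" using x(3) by linarith
  then obtain t where t: "v = [t]" by (cases v) auto
  have r': "reduced (x @ v)"
    by (rule reduced_cong_length[OF cox_sym[OF v(2)] _ reduced_longest]) (simp add: v(3))
  have "s # x \<approx> longest" by (rule matsumoto[OF r reduced_longest x(2)])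
  moreover have "x @ v \<approx> longest" by (rule matsumoto[OF r' reduced_longest v(2)])
  ultimately show ?thesis using t v(1) x(1) by (intro bexI[of _ t] exI[of _ x]) simp_all
qed

lemma longest_conjugate_letter:
  assumes "s \<in> S"
  shows "\<exists>t\<in>S. s # longest \<approx> longest @ [t]"
proof -
  obtain t x where t: "t \<in> S" "s # x \<approx> longest" "x @ [t] \<approx> longest"
    using longest_conjugate[OF assms] by blast
  have "s # longest \<approx> s # (x @ [t])" by (rule braid_Cons[OF braid_sym[OF t(3)]])
  also have "s # (x @ [t]) = (s # x) @ [t]" by simp
  also have "\<dots> \<approx> longest @ [t]" by (intro braid_append t(2) braid_refl)
  finally show ?thesis using t(1) by blast
qed

text \<open>The square of the Garside element. Conjugation by the Garside element permutes the generators and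
  is an involution, so that its square is central.\<close>

definition garside :: "'a list" where
  "garside = longest @ longest"

lemma garside_set: "set garside \<subseteq> S"
  using longest_set by (auto simp: garside_def)

lemma garside_central_letter:
  assumes "s \<in> S"
  shows "s # garside \<approx> garside @ [s]"
proof -
  obtain t where t: "t \<in> S" "s # longest \<approx> longest @ [t]"
    using longest_conjugate_letter[OF assms] by blast
  obtain r where r: "t # longest \<approx> longest @ [r]"
    using longest_conjugate_letter[OF t(1)] by blast
  have "s # garside = (s # longest) @ longest" by (simp add: garside_def)
  also have "\<dots> \<approx> (longest @ [t]) @ longest" by (intro braid_append t(2) braid_refl)
  also have "\<dots> = longest @ t # longest" by simp
  also have "\<dots> \<approx> longest @ longest @ [r]" by (intro braid_append r braid_refl)
  finally have 1: "s # garside \<approx> garside @ [r]" by (simp add: garside_def)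
  \<comment> \<open>\<open>garside\<close> is trivial in the Coxeter group, so that \<open>r\<close> and \<open>s\<close> have the same image there\<close>
  have g: "garside \<sim> []" unfolding garside_def by (rule longest_involution)
  have "[s] @ [] \<sim> [s] @ garside" by (rule cox_append[OF cox_refl cox_sym[OF g]])
  also have "[s] @ garside \<sim> garside @ [r]" using braid_imp_cox[OF 1] by simp
  also have "\<dots> \<sim> [] @ [r]" by (rule cox_append[OF g cox_refl])
  finally have "[s] \<approx> [r]" using matsumoto[OF reduced_letter reduced_letter] by simp
  then have "r = s" using braid_set by fastforce
  then show ?thesis using 1 by simp
qed

definition garside_pow :: "nat \<Rightarrow> 'a list" where
  "garside_pow k = concat (replicate k garside)"

lemma garside_pow_0 [simp]: "garside_pow 0 = []"
  and garside_pow_Suc: "garside_pow (Suc k) = garside @ garside_pow k"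
  and garside_pow_add: "garside_pow (j + k) = garside_pow j @ garside_pow k"
  by (simp_all add: garside_pow_def replicate_add)

lemma garside_pow_set: "set (garside_pow k) \<subseteq> S"
  by (induction k) (use garside_set in \<open>auto simp: garside_pow_Suc\<close>)

lemma garside_central: "set u \<subseteq> S \<Longrightarrow> u @ garside \<approx> garside @ u"
proof (induction u)
  case (Cons s u)
  have "s # u @ garside \<approx> s # garside @ u" using Cons by (auto intro: braid_Cons)
  also have "\<dots> = (s # garside) @ u" by simp
  also have "\<dots> \<approx> (garside @ [s]) @ u"
    using Cons.prems by (intro braid_append garside_central_letter braid_refl) auto
  finally show ?case by simp
qed simp

lemma garside_pow_central: "set u \<subseteq> S \<Longrightarrow> u @ garside_pow k \<approx> garside_pow k @ u"
proof (induction k)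
  case (Suc k)
  have "u @ garside_pow (Suc k) = (u @ garside) @ garside_pow k" by (simp add: garside_pow_Suc)
  also have "\<dots> \<approx> (garside @ u) @ garside_pow k"
    by (intro braid_append garside_central Suc.prems braid_refl)
  also have "\<dots> = garside @ (u @ garside_pow k)" by simp
  also have "\<dots> \<approx> garside @ (garside_pow k @ u)"
    by (intro braid_append Suc braid_refl)
  finally show ?case by (simp add: garside_pow_Suc)
qed simp

text \<open>A positive word that represents, in the group, \<open>garside\<close> times the inverse of \<open>s\<close>.\<close>

definition complement :: "'a \<Rightarrow> 'a list" where
  "complement s = (SOME x. set x \<subseteq> S \<and> s # x \<approx> garside)"

lemma complement:
  assumes "s \<in> S"
  shows "set (complement s) \<subseteq> S" "s # complement s \<approx> garside" "complement s @ [s] \<approx> garside"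
proof -
  obtain x where x: "set x \<subseteq> S" "s # x \<approx> longest"
    using longest_conjugate[OF assms] by blast
  have "(s # x) @ longest \<approx> garside" unfolding garside_def by (intro braid_append x braid_refl)
  then have "\<exists>x. set x \<subseteq> S \<and> s # x \<approx> garside"
    using x longest_set by (intro exI[of _ "x @ longest"]) auto
  from someI_ex[OF this] show c: "set (complement s) \<subseteq> S" "s # complement s \<approx> garside"
    unfolding complement_def by auto
  have "s # complement s @ [s] = (s # complement s) @ [s]" by simp
  also have "\<dots> \<approx> garside @ [s]" by (intro braid_append c braid_refl)
  also have "\<dots> \<approx> s # garside" by (rule braid_sym[OF garside_central_letter[OF assms]])
  finally show "complement s @ [s] \<approx> garside" by (rule braid_cancel_left_Cons)
qed

lemma divides_garside_pow:
  assumes "set u \<subseteq> S"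
  shows "\<exists>x. set x \<subseteq> S \<and> u @ x \<approx> garside_pow (length u)"
  using assms
proof (induction u)
  case (Cons s u)
  then obtain x where x: "set x \<subseteq> S" "u @ x \<approx> garside_pow (length u)" by auto
  have s: "s \<in> S" using Cons.prems by simp
  have "(s # u) @ x @ complement s = s # (u @ x) @ complement s" by simp
  also have "\<dots> \<approx> s # garside_pow (length u) @ complement s"
    by (intro braid_Cons braid_append x braid_refl)
  also have "\<dots> = ([s] @ garside_pow (length u)) @ complement s" by simp
  also have "\<dots> \<approx> (garside_pow (length u) @ [s]) @ complement s"
    using s by (intro braid_append garside_pow_central braid_refl) auto
  also have "\<dots> = garside_pow (length u) @ s # complement s" by simp
  also have "\<dots> \<approx> garside_pow (length u) @ garside"
    by (intro braid_append complement s braid_refl)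
  also have "\<dots> \<approx> garside_pow (length (s # u))"
    using braid_sym[OF garside_central[OF garside_pow_set]] garside_central[OF garside_pow_set, of "length u"]
    by (simp add: garside_pow_Suc)
  finally show ?case using x(1) complement(1)[OF s] by (intro exI[of _ "x @ complement s"]) auto
qed (auto intro: exI[of _ "[]"])

lemma common_multiple:
  assumes "set u \<subseteq> S" "set v \<subseteq> S"
  shows "\<exists>x y. set x \<subseteq> S \<and> set y \<subseteq> S \<and> u @ x \<approx> v @ y"
proof -
  have *: "\<exists>x. set x \<subseteq> S \<and> u @ x \<approx> garside_pow (length u + k)" if u: "set u \<subseteq> S" for u k
  proof -
    obtain x where x: "set x \<subseteq> S" "u @ x \<approx> garside_pow (length u)"
      using divides_garside_pow[OF u] by blast
    have "(u @ x) @ garside_pow k \<approx> garside_pow (length u + k)"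
      unfolding garside_pow_add by (intro braid_append x braid_refl)
    then show ?thesis using x(1) garside_pow_set by (intro exI[of _ "x @ garside_pow k"]) auto
  qed
  obtain x y where xy: "set x \<subseteq> S" "set y \<subseteq> S"
    "u @ x \<approx> garside_pow (length u + length v)" "v @ y \<approx> garside_pow (length v + length u)"
    using *[OF assms(1)] *[OF assms(2)] by blast
  have "u @ x \<approx> v @ y"
    using braid_trans[OF xy(3) braid_sym[OF xy(4)[unfolded add.commute[of "length v"]]]] .
  then show ?thesis using xy(1,2) by blast
qed

end

section \<open>The monoid embeds in the group\<close>

lemma alternating_alt: "alternating s t n = map Pos (alt s t n)"
  by (induction s t n rule: alternating.induct) auto

text \<open>The presentation given by the matrix \<open>m\<close>. All letters with a relation lie in \<open>S\<close>, as the presentation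
  is positive.\<close>

locale artin_tits_spherical = finite_coxeter m S for m :: "'a \<Rightarrow> 'a \<Rightarrow> nat" and S +
  fixes R :: "('a word \<times> 'a word) set"
  assumes relation_iff: "is_relation R v v' \<longleftrightarrow>
      (\<exists>s t. s \<noteq> t \<and> m s t \<noteq> 0 \<and> v = map Pos (alt s t (m s t)) \<and> v' = map Pos (alt t s (m s t)))"
    and positive: "positive_presentation S R"
begin

text \<open>Since \<open>garside\<close> is central, a word in signed letters equals a fraction with a positive numerator,
  in which \<open>complement s\<close> replaces the inverse of \<open>s\<close>, and with the power of \<open>garside\<close> given by the number
  of negative letters as denominator.\<close>

fun positive_letter :: "'a letter \<Rightarrow> 'a list" where
  "positive_letter (Pos s) = [s]"
| "positive_letter (Neg s) = complement s"

definition numerator :: "'a word \<Rightarrow> 'a list" where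
  "numerator w = concat (map positive_letter w)"

definition negs :: "'a word \<Rightarrow> nat" where
  "negs w = length (filter (\<lambda>a. a \<in> range Neg) w)"

lemma numerator_append: "numerator (u @ v) = numerator u @ numerator v"
  by (simp add: numerator_def)

lemma numerator_pos [simp]: "numerator (map Pos u) = u"
  by (induction u) (auto simp: numerator_def)

lemma negs_append: "negs (u @ v) = negs u + negs v"
  by (simp add: negs_def)

lemma negs_pos [simp]: "negs (map Pos u) = 0"
  by (simp add: negs_def filter_map o_def image_iff)

lemma numerator_set: "w \<in> words S \<Longrightarrow> set (numerator w) \<subseteq> S"
proof (induction w)
  case (Cons a w)
  then show ?case using complement(1) by (cases a) (auto simp: numerator_def)
qed (simp add: numerator_def)

lemma numerator_cancel:
  assumes "x \<in> words S" "positive_letter a @ positive_letter b \<approx> garside" "negs [a, b] = 1"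
  shows "garside_pow (negs (x @ y)) @ numerator (x @ [a, b] @ y)
    \<approx> garside_pow (negs (x @ [a, b] @ y)) @ numerator (x @ y)"
proof -
  have n: "negs (x @ [a, b] @ y) = Suc (negs (x @ y))"
    using assms(3) negs_append[of "[a, b]" y] by (simp add: negs_append del: append.simps)
  let ?k = "negs (x @ y)"
  have "garside_pow ?k @ numerator (x @ [a, b] @ y)
      = garside_pow ?k @ numerator x @ (positive_letter a @ positive_letter b) @ numerator y"
    by (simp add: numerator_def)
  also have "\<dots> \<approx> garside_pow ?k @ numerator x @ garside @ numerator y"
    by (intro braid_append braid_refl assms)
  also have "\<dots> = garside_pow ?k @ (numerator x @ garside) @ numerator y" by simp
  also have "\<dots> \<approx> garside_pow ?k @ (garside @ numerator x) @ numerator y"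
    by (intro braid_append braid_refl garside_central numerator_set assms)
  also have "\<dots> = (garside_pow ?k @ garside) @ numerator (x @ y)" by (simp add: numerator_append)
  also have "\<dots> \<approx> (garside @ garside_pow ?k) @ numerator (x @ y)"
    by (intro braid_append braid_refl garside_central garside_pow_set)
  finally show ?thesis unfolding n garside_pow_Suc .
qed

text \<open>Congruent words have equal fractions in the sense of cross-multiplication. Transitivity relies on
  left cancellation in the monoid.\<close>

lemma pres_cong_numerator:
  "(u, v) \<in> pres_cong S R \<Longrightarrow>
    garside_pow (negs v) @ numerator u \<approx> garside_pow (negs u) @ numerator v"
proof (induction rule: pres_cong.induct)
  case (rel v v' x y)
  then have "is_relation R v v'" by (simp add: is_relation_def)
  then obtain s t where st: "s \<noteq> t" "m s t \<noteq> 0" "v = map Pos (alt s t (m s t))" "v' = map Pos (alt t s (m s t))"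
    unfolding relation_iff by blast
  have "numerator v \<approx> numerator v'" using braid_rel[OF st(1,2)] st by simp
  then have "numerator (x @ v @ y) \<approx> numerator (x @ v' @ y)"
    unfolding numerator_append by (intro braid_append braid_refl)
  moreover have "negs (x @ v @ y) = negs (x @ v' @ y)" using st by (simp add: negs_append)
  ultimately show ?case by (simp add: braid_append)
next
  case (cancel_right s x y)
  then show ?case using numerator_cancel[of x "Pos s" "Neg s" y] complement[of s] by (auto simp: negs_def)
next
  case (cancel_left s x y)
  then show ?case using numerator_cancel[of x "Neg s" "Pos s" y] complement[of s] by (auto simp: negs_def)
next
  case (refl w)
  then show ?case by simp
next
  case (sym v w)
  show ?case by (rule braid_sym[OF sym.IH])
next
  case (trans u v w)
  let ?g = garside_pow
  have comm: "?g i @ ?g j @ x = ?g j @ ?g i @ x" for i j x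
    using garside_pow_add[of i j] garside_pow_add[of j i] by (simp add: add.commute)
  have "?g (negs v) @ ?g (negs w) @ numerator u = ?g (negs w) @ ?g (negs v) @ numerator u"
    by (rule comm)
  also have "\<dots> \<approx> ?g (negs w) @ ?g (negs u) @ numerator v"
    by (intro braid_append braid_refl trans.IH)
  also have "\<dots> = ?g (negs u) @ ?g (negs w) @ numerator v" by (rule comm)
  also have "\<dots> \<approx> ?g (negs u) @ ?g (negs v) @ numerator w"
    by (intro braid_append braid_refl trans.IH)
  also have "\<dots> = ?g (negs v) @ ?g (negs u) @ numerator w" by (rule comm)
  finally show ?case by (rule braid_cancel_left)
qed

theorem monoid_embeds: "(map Pos u, map Pos v) \<in> pres_cong S R \<Longrightarrow> u \<approx> v"
  using pres_cong_numerator[of "map Pos u" "map Pos v"] by simp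

end

section \<open>Soundness of the special transformations\<close>

lemma inv_word_append: "inv_word (u @ v) = inv_word v @ inv_word u"
  by (simp add: inv_word_def)

lemma inv_word_inv_word: "inv_word (inv_word w) = w" for w :: "'a word"
proof -
  have "inv_letter (inv_letter a) = a" for a :: "'a letter" by (cases a) auto
  then show ?thesis by (simp add: inv_word_def rev_map o_def)
qed

lemma map_Pos_words: "map Pos u \<in> words S \<longleftrightarrow> set u \<subseteq> S"
  by (induction u) auto

lemma pos_words_words: "w \<in> pos_words S \<Longrightarrow> w \<in> words S"
  unfolding pos_words_def words_def by auto

lemma inv_word_cancel_right: "w \<in> words S \<Longrightarrow> (w @ inv_word w, []) \<in> pres_cong S R"
  using inv_word_cancel[of "inv_word w" S R] by (simp add: inv_word_inv_word)

lemma pres_cong_insert: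
  assumes "(z, []) \<in> pres_cong S R" "x \<in> words S" "y \<in> words S"
  shows "(x @ y, x @ z @ y) \<in> pres_cong S R"
  using pres_cong.sym[OF pres_cong_context[OF assms]] by simp

lemma is_relation_pres_cong:
  assumes "positive_presentation S R" "is_relation R v v'"
  shows "(v, v') \<in> pres_cong S R"
proof -
  have *: "v \<in> words S" "v' \<in> words S" if "(v, v') \<in> R" for v v'
    using that assms(1) unfolding positive_presentation_def by (auto intro: pos_words_words)
  show ?thesis
    using assms(2) pres_cong.rel[of v v' R "[]" S "[]"] pres_cong.rel[of v' v R "[]" S "[]"]
      * pres_cong.sym[of v' v S R]
    unfolding is_relation_def by auto
qed

lemma special_pres_cong:
  assumes "positive_presentation S R" "special S R w w'" "w \<in> words S"
  shows "(w, w') \<in> pres_cong S R"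
proof -
  note app = append_assoc append_Nil append_Nil2
  show ?thesis
    using assms(2,3)
  proof cases
    case (type0_left s x y)
    then show ?thesis using assms(3) pres_cong.cancel_left[of s S x y R] by simp
  next
    case (type0_right s x y)
    then show ?thesis using assms(3) pres_cong.cancel_right[of s S x y R] by simp
  next
    case (type1_pos v v' x y)
    then show ?thesis
      using assms(3) pres_cong_context[OF is_relation_pres_cong[OF assms(1)]] by simp
  next
    case (type1_neg v v' x y)
    note r = is_relation_pres_cong[OF assms(1) type1_neg(3)]
    note vw = pres_cong_words[OF r]
    have 1: "(inv_word v @ [], inv_word v @ (v' @ inv_word v') @ []) \<in> pres_cong S R"
      using vw by (intro pres_cong_insert inv_word_cancel_right) auto
    have 2: "(inv_word v @ (v' @ inv_word v') @ [], inv_word v @ v @ inv_word v') \<in> pres_cong S R"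
      using pres_cong.sym[OF pres_cong_context[OF r, of "inv_word v" "inv_word v'"]] vw by simp
    have 3: "([] @ (inv_word v @ v) @ inv_word v', [] @ [] @ inv_word v') \<in> pres_cong S R"
      using vw by (intro pres_cong_context inv_word_cancel) auto
    have "(inv_word v, inv_word v') \<in> pres_cong S R"
      using pres_cong.trans[OF pres_cong.trans[OF 1[unfolded app] 2[unfolded app]] 3[unfolded app]] by simp
    then show ?thesis
      using assms(3) type1_neg pres_cong_context by auto
  next
    case (type2_right v v' u u' x y)
    note r = is_relation_pres_cong[OF assms(1) type2_right(7)]
    have vw: "v \<in> words S" "u \<in> words S" "v' \<in> words S" "u' \<in> words S"
      using pres_cong_words[OF r] by auto
    have 1: "((inv_word v @ v') @ [], (inv_word v @ v') @ (u' @ inv_word u') @ []) \<in> pres_cong S R"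
      using vw by (intro pres_cong_insert inv_word_cancel_right) auto
    have 2: "(inv_word v @ (v' @ u') @ inv_word u', inv_word v @ (v @ u) @ inv_word u') \<in> pres_cong S R"
      using vw by (intro pres_cong_context pres_cong.sym[OF r]) auto
    have 3: "([] @ (inv_word v @ v) @ (u @ inv_word u'), [] @ [] @ (u @ inv_word u')) \<in> pres_cong S R"
      using vw by (intro pres_cong_context inv_word_cancel) auto
    have "(inv_word v @ v', u @ inv_word u') \<in> pres_cong S R"
      using pres_cong.trans[OF pres_cong.trans[OF 1[unfolded app] 2[unfolded app]] 3[unfolded app]] by simp
    from pres_cong_context[OF this, of x y] show ?thesis using assms(3) type2_right by simp
  next
    case (type2_left v v' u u' x y)
    note r = is_relation_pres_cong[OF assms(1) type2_left(7)]
    have vw: "v \<in> words S" "u \<in> words S" "v' \<in> words S" "u' \<in> words S"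
      using pres_cong_words[OF r] by auto
    have 1: "([] @ (v @ inv_word v'), [] @ (inv_word u @ u) @ (v @ inv_word v')) \<in> pres_cong S R"
      using vw by (intro pres_cong_insert inv_word_cancel) auto
    have 2: "(inv_word u @ (u @ v) @ inv_word v', inv_word u @ (u' @ v') @ inv_word v') \<in> pres_cong S R"
      using vw by (intro pres_cong_context r) auto
    have 3: "((inv_word u @ u') @ (v' @ inv_word v') @ [], (inv_word u @ u') @ [] @ []) \<in> pres_cong S R"
      using vw by (intro pres_cong_context inv_word_cancel_right) auto
    have "(v @ inv_word v', inv_word u @ u') \<in> pres_cong S R"
      using pres_cong.trans[OF pres_cong.trans[OF 1[unfolded app] 2[unfolded app]] 3[unfolded app]] by simp
    from pres_cong_context[OF this, of x y] show ?thesis using assms(3) type2_left by simp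
  qed
qed

lemma special_star_pres_cong:
  assumes "positive_presentation S R" "(special S R)\<^sup>*\<^sup>* w w'" "w \<in> words S"
  shows "(w, w') \<in> pres_cong S R"
  using assms(2)
proof (induction rule: rtranclp_induct)
  case base
  show ?case by (rule pres_cong.refl[OF assms(3)])
next
  case (step v w')
  show ?case
    by (rule pres_cong.trans[OF step.IH special_pres_cong[OF assms(1) step.hyps(2) pres_cong_words(2)[OF step.IH]]])
qed

lemma special_context: "special S R u v \<Longrightarrow> special S R (x @ u @ y) (x @ v @ y)"
proof (induction rule: special.induct)
  case (type0_left s a b)
  then show ?case using special.type0_left[of s S R "x @ a" "b @ y"] by simp
next
  case (type0_right s a b)
  then show ?case using special.type0_right[of s S R "x @ a" "b @ y"] by simp
next
  case (type1_pos v v' a b)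
  then show ?case using special.type1_pos[of R v v' S "x @ a" "b @ y"] by simp
next
  case (type1_neg v v' a b)
  then show ?case using special.type1_neg[of R v v' S "x @ a" "b @ y"] by simp
next
  case (type2_right v v' u u' a b)
  then show ?case using special.type2_right[of v S v' R u u' "x @ a" "b @ y"] by simp
next
  case (type2_left v v' u u' a b)
  then show ?case using special.type2_left[of v S v' R u u' "x @ a" "b @ y"] by simp
qed

lemma special_star_context:
  "(special S R)\<^sup>*\<^sup>* u v \<Longrightarrow> (special S R)\<^sup>*\<^sup>* (x @ u @ y) (x @ v @ y)"
proof (induction rule: rtranclp_induct)
  case (step v w)
  show ?case
    by (rule rtranclp.rtrancl_into_rtrancl[OF step.IH special_context[OF step.hyps(2)]])
qed simp

section \<open>Reversing\<close>

context artin_tits_spherical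
begin

abbreviation reduces :: "'a word \<Rightarrow> 'a word \<Rightarrow> bool"  (infix "\<leadsto>" 50) where
  "w \<leadsto> w' \<equiv> (special S R)\<^sup>*\<^sup>* w w'"

abbreviation pos :: "'a list \<Rightarrow> 'a word" where
  "pos u \<equiv> map Pos u"

text \<open>A common right multiple \<open>u @ x \<approx> v @ y\<close> bounds the length of everything that occurs during the
  reversal of \<open>inv_word (pos u) @ pos v\<close>, hence the induction. The factor \<open>z\<close> expresses that \<open>x'\<close> and \<open>y'\<close>
  divide \<open>x\<close> and \<open>y\<close> with the same quotient, which is what makes the subproblems composable.\<close>

lemma reversing:
  assumes "u @ x \<approx> v @ y" "set (u @ x) \<subseteq> S"
  shows "\<exists>x' y' z. inv_word (pos u) @ pos v \<leadsto> pos x' @ inv_word (pos y')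
           \<and> x \<approx> x' @ z \<and> y \<approx> y' @ z"
  using assms
proof (induction "length (u @ x)" arbitrary: u x v y rule: less_induct)
  case less
  have sets: "set (u @ x) = set (v @ y)" using braid_set[OF less.prems(1)] .
  show ?case
  proof (cases "u = [] \<or> v = []")
    case True
    then show ?thesis
    proof
      assume "u = []"
      then show ?thesis using less.prems(1)
        by (intro exI[of _ v] exI[of _ "[]"] exI[of _ y]) (simp add: inv_word_def)
    next
      assume "v = []"
      then show ?thesis using braid_sym[OF less.prems(1)]
        by (intro exI[of _ "[]"] exI[of _ u] exI[of _ x]) (simp add: inv_word_def)
    qed
  next
    case False
    then obtain s u1 t v1 where uv: "u = s # u1" "v = t # v1" by (meson neq_Nil_conv)
    have start: "inv_word (pos u) @ pos v = inv_word (pos u1) @ [Neg s, Pos t] @ pos v1"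
      by (simp add: uv inv_word_def)
    have lt: "length (u1 @ x) < length (u @ x)" using uv by simp
    have sS: "s \<in> S" using less.prems(2) uv by simp
    show ?thesis
    proof (cases "s = t")
      case True
      have "u1 @ x \<approx> v1 @ y" using less.prems(1) braid_cancel_left_Cons uv True by simp
      from less.hyps[OF lt this] less.prems(2) uv obtain x' y' z where
        *: "inv_word (pos u1) @ pos v1 \<leadsto> pos x' @ inv_word (pos y')" "x \<approx> x' @ z" "y \<approx> y' @ z"
        by auto
      have "special S R (inv_word (pos u) @ pos v) (inv_word (pos u1) @ pos v1)"
        unfolding start True[symmetric] by (rule special.type0_left[OF sS])
      from converse_rtranclp_into_rtranclp[of "special S R", OF this *(1)] show ?thesis using *(2,3) by blast
    next
      case False
      have "s # (u1 @ x) \<approx> t # (v1 @ y)" using less.prems(1) uv by simp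
      from braid_common_multiple[OF this False] obtain z0 where m: "m s t \<noteq> 0"
        and z0: "u1 @ x \<approx> alt t s (m s t - 1) @ z0" "v1 @ y \<approx> alt s t (m s t - 1) @ z0" by blast
      \<comment> \<open>one transformation of type 2 turns the middle factor into \<open>a b\<close> with \<open>b\<close> inverted; then the left
        half, the right half and the resulting middle part are reversed\<close>
      define a where "a = alt t s (m s t - 1)"
      define b where "b = alt s t (m s t - 1)"
      note ua = z0(1)[folded a_def] and vb = z0(2)[folded b_def]
      have "t \<in> set (u @ x)" unfolding sets by (simp add: uv)
      then have tS: "t \<in> S" using less.prems(2) by blast
      have "is_relation R ([Pos s] @ pos a) ([Pos t] @ pos b)"
        unfolding relation_iff a_def b_def using False m alt_pred[OF m] alt_pred[of t s] m_sym[of t s]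
        by (intro exI[of _ s] exI[of _ t]) simp
      from special.type2_right[OF _ _ _ _ this, of S "inv_word (pos u1)" "pos v1"] sS tS
      have 0: "special S R (inv_word (pos u) @ pos v) (inv_word (pos u1) @ pos a @ inv_word (pos b) @ pos v1)"
        unfolding start by (simp add: pos_words_def inv_word_def)
      have Su: "set (u1 @ x) \<subseteq> S" using less.prems(2) uv by simp
      have Sv: "set (b @ z0) \<subseteq> S" using sets less.prems(2) uv braid_set[OF vb] by auto
      from less.hyps[OF lt ua Su] obtain p q z1 where
        1: "inv_word (pos u1) @ pos a \<leadsto> pos p @ inv_word (pos q)" "x \<approx> p @ z1" "z0 \<approx> q @ z1" by blast
      have "length (b @ z0) < length (u @ x)"
        using braid_length[OF vb] braid_length[OF less.prems(1)] uv by simp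
      from less.hyps[OF this braid_sym[OF vb] Sv] obtain p' q' z2 where
        2: "inv_word (pos b) @ pos v1 \<leadsto> pos p' @ inv_word (pos q')" "z0 \<approx> p' @ z2" "y \<approx> q' @ z2" by blast
      have "length (q @ z1) < length (u @ x)"
        using braid_length[OF 1(3)] braid_length[OF ua] lt by simp
      moreover have "q @ z1 \<approx> p' @ z2" by (rule braid_trans[OF braid_sym[OF 1(3)] 2(2)])
      moreover have "set (q @ z1) \<subseteq> S" using braid_set[OF 1(3)] Sv by simp
      ultimately obtain p'' q'' z where
        3: "inv_word (pos q) @ pos p' \<leadsto> pos p'' @ inv_word (pos q'')" "z1 \<approx> p'' @ z" "z2 \<approx> q'' @ z"
        using less.hyps by blast
      have "inv_word (pos u) @ pos v \<leadsto> inv_word (pos u1) @ pos a @ inv_word (pos b) @ pos v1"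
        using 0 by (rule r_into_rtranclp)
      also have "\<dots> \<leadsto> pos p @ inv_word (pos q) @ inv_word (pos b) @ pos v1"
        using special_star_context[OF 1(1), of "[]" "inv_word (pos b) @ pos v1"] by simp
      also have "\<dots> \<leadsto> pos p @ inv_word (pos q) @ pos p' @ inv_word (pos q')"
        using special_star_context[OF 2(1), of "pos p @ inv_word (pos q)" "[]"] by simp
      also have "\<dots> \<leadsto> pos p @ pos p'' @ inv_word (pos q'') @ inv_word (pos q')"
        using special_star_context[OF 3(1), of "pos p" "inv_word (pos q')"] by simp
      also have "\<dots> = pos (p @ p'') @ inv_word (pos (q' @ q''))" by (simp add: inv_word_append)
      finally have "inv_word (pos u) @ pos v \<leadsto> pos (p @ p'') @ inv_word (pos (q' @ q''))" .
      moreover have "x \<approx> (p @ p'') @ z"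
        using braid_trans[OF 1(2) braid_append[OF braid_refl 3(2)]] by simp
      moreover have "y \<approx> (q' @ q'') @ z"
        using braid_trans[OF 2(3) braid_append[OF braid_refl 3(3)]] by simp
      ultimately show ?thesis by blast
    qed
  qed
qed

lemma reduces_to_fraction:
  assumes "w \<in> words S"
  shows "\<exists>p q. set p \<subseteq> S \<and> set q \<subseteq> S \<and> w \<leadsto> pos p @ inv_word (pos q)"
  using assms
proof (induction w)
  case Nil
  then show ?case by (intro exI[of _ "[]"]) (simp add: inv_word_def)
next
  case (Cons a w)
  then have "w \<in> words S" by (cases a) auto
  then obtain p q where pq: "set p \<subseteq> S" "set q \<subseteq> S" "w \<leadsto> pos p @ inv_word (pos q)"
    using Cons.IH by blast
  have aw: "a # w \<leadsto> a # pos p @ inv_word (pos q)"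
    using special_star_context[OF pq(3), of "[a]" "[]"] by simp
  show ?case
  proof (cases a)
    case (Pos s)
    then show ?thesis using aw pq Cons.prems by (intro exI[of _ "s # p"] exI[of _ q]) auto
  next
    case (Neg s)
    then have s: "set [s] \<subseteq> S" using Cons.prems by simp
    obtain x y where xy: "set x \<subseteq> S" "set y \<subseteq> S" "[s] @ x \<approx> p @ y"
      using common_multiple[OF s pq(1)] by blast
    have "set ([s] @ x) \<subseteq> S" using s xy(1) by auto
    from reversing[OF xy(3) this] obtain x' y' z where
      r: "inv_word (pos [s]) @ pos p \<leadsto> pos x' @ inv_word (pos y')" "x \<approx> x' @ z" "y \<approx> y' @ z" by blast
    have "set x' \<subseteq> S" "set y' \<subseteq> S" using braid_set[OF r(2)] braid_set[OF r(3)] xy(1,2) by auto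
    moreover have "a # pos p @ inv_word (pos q) \<leadsto> pos x' @ inv_word (pos y') @ inv_word (pos q)"
      using special_star_context[OF r(1), of "[]" "inv_word (pos q)"] Neg by (simp add: inv_word_def)
    then have "a # w \<leadsto> pos x' @ inv_word (pos (q @ y'))"
      using rtranclp_trans[OF aw] by (simp add: inv_word_append)
    ultimately show ?thesis using pq(2) by (intro exI[of _ x'] exI[of _ "q @ y'"]) auto
  qed
qed

lemma braid_reduces: "u \<approx> v \<Longrightarrow> pos u \<leadsto> pos v"
  unfolding braid_eq_def
proof (induction rule: rtranclp_induct)
  case (step v w)
  obtain x y s t where *: "s \<noteq> t" "m s t \<noteq> 0" "v = x @ alt s t (m s t) @ y"
    "w = x @ alt t s (m s t) @ y" using step.hyps(2) unfolding braid_step_def by blast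
  have "is_relation R (pos (alt s t (m s t))) (pos (alt t s (m s t)))"
    unfolding relation_iff using *(1,2) by blast
  from special.type1_pos[OF this, of S "pos x" "pos y"] have "special S R (pos v) (pos w)"
    unfolding *(3,4) by simp
  with step.IH show ?case by (rule rtranclp.rtrancl_into_rtrancl)
qed simp

lemma reduces_cancel: "set u \<subseteq> S \<Longrightarrow> pos u @ inv_word (pos u) \<leadsto> []"
proof (induction u rule: rev_induct)
  case (snoc s u)
  have "special S R (pos u @ [Pos s, Neg s] @ inv_word (pos u)) (pos u @ inv_word (pos u))"
    using snoc.prems by (intro special.type0_right) auto
  moreover have "pos u @ inv_word (pos u) \<leadsto> []" using snoc by auto
  ultimately show ?case
    by (simp add: inv_word_append) (simp add: inv_word_def converse_rtranclp_into_rtranclp)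
qed (simp add: inv_word_def)

theorem property_H: "property_H S R"
  unfolding property_H_def
proof (intro ballI impI)
  fix w assume w: "w \<in> words S" "word_class S R w = \<one>\<^bsub>presented_group S R\<^esub>"
  then have w1: "(w, []) \<in> pres_cong S R"
    unfolding one_presented_group by (simp add: word_class_eq_iff)
  obtain p q where pq: "set p \<subseteq> S" "set q \<subseteq> S" "w \<leadsto> pos p @ inv_word (pos q)"
    using reduces_to_fraction[OF w(1)] by blast
  have ps: "pos p \<in> words S" "pos q \<in> words S"
    using pq(1,2) by (simp_all add: map_Pos_words)
  have "(pos p @ inv_word (pos q), []) \<in> pres_cong S R"
    using pres_cong.trans[OF pres_cong.sym[OF special_star_pres_cong[OF positive pq(3) w(1)]] w1] .
  from pres_cong_context[OF this, of "[]" "pos q"]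
  have "(pos p @ inv_word (pos q) @ pos q, pos q) \<in> pres_cong S R" using ps by simp
  moreover have "(pos p @ [], pos p @ (inv_word (pos q) @ pos q) @ []) \<in> pres_cong S R"
    using ps by (intro pres_cong_insert inv_word_cancel) auto
  ultimately have "(pos p, pos q) \<in> pres_cong S R"
    using pres_cong.trans[of "pos p" "pos p @ inv_word (pos q) @ pos q"] by simp
  then have "p \<approx> q" by (rule monoid_embeds)
  then have "pos p @ inv_word (pos q) \<leadsto> pos q @ inv_word (pos q)"
    using special_star_context[OF braid_reduces, of p q "[]" "inv_word (pos q)"] by simp
  then show "w \<leadsto> []"
    using pq(3) reduces_cancel[OF pq(2)] by (meson rtranclp_trans)
qed

end

section \<open>Spherical Artin--Tits presentations\<close>

text \<open>The Coxeter matrix of an Artin--Tits presentation, with \<open>0\<close> on the diagonal and for pairs without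
  a relation.\<close>

definition coxeter_entry :: "('a word \<times> 'a word) set \<Rightarrow> 'a \<Rightarrow> 'a \<Rightarrow> nat" where
  "coxeter_entry R s t =
     (if s \<noteq> t \<and> (\<exists>n. is_relation R (alternating s t n) (alternating t s n))
      then (THE n. is_relation R (alternating s t n) (alternating t s n)) else 0)"

lemma is_relation_sym: "is_relation R v w = is_relation R w v"
  by (auto simp: is_relation_def)

lemma alternating_eqD:
  assumes "alternating s t n = alternating s' t' k" "n \<ge> 2 \<or> k \<ge> 2"
  shows "n = k \<and> s = s' \<and> t = t'"
proof -
  have "length (alternating s t n) = length (alternating s' t' k)" using assms(1) by simp
  then have nk: "n = k" by (simp add: alternating_alt)
  then obtain j where "n = Suc (Suc j)" using assms(2) by (metis add_2_eq_Suc le_Suc_ex)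
  then show ?thesis using assms(1) nk by simp
qed

lemma artin_tits_relation:
  assumes "artin_tits_presentation S R" "is_relation R v w"
  shows "\<exists>s\<in>S. \<exists>t\<in>S. \<exists>n\<ge>2. s \<noteq> t \<and> v = alternating s t n \<and> w = alternating t s n"
proof -
  have *: "\<exists>s\<in>S. \<exists>t\<in>S. \<exists>n\<ge>2. s \<noteq> t \<and> r = (alternating s t n, alternating t s n)" if "r \<in> R" for r
    using assms(1)[unfolded artin_tits_presentation_def, THEN conjunct1] that by (rule bspec)
  from assms(2) consider "(v, w) \<in> R" | "(w, v) \<in> R" unfolding is_relation_def by blast
  then show ?thesis
  proof cases
    case 1
    from *[OF this] show ?thesis by simp
  next
    case 2
    from *[OF this] show ?thesis by (metis prod.inject)
  qed
qed

lemma coxeter_entry_eq: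
  assumes at: "artin_tits_presentation S R" and "s \<in> S" "t \<in> S" "s \<noteq> t"
    and r: "is_relation R (alternating s t n) (alternating t s n)"
  shows "coxeter_entry R s t = n"
proof -
  have "k = n" if "is_relation R (alternating s t k) (alternating t s k)" for k
    using at[unfolded artin_tits_presentation_def, THEN conjunct2, rule_format, OF assms(2-4) that r] .
  with r have "(THE n. is_relation R (alternating s t n) (alternating t s n)) = n"
    by (rule the_equality)
  then show ?thesis using assms(4) r unfolding coxeter_entry_def by auto
qed

lemma coxeter_entry_nonzero:
  assumes at: "artin_tits_presentation S R" and nz: "coxeter_entry R s t \<noteq> 0"
  defines "n \<equiv> coxeter_entry R s t"
  shows "s \<in> S" "t \<in> S" "s \<noteq> t" "n \<ge> 2" "is_relation R (alternating s t n) (alternating t s n)"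
proof -
  show st: "s \<noteq> t" using nz unfolding coxeter_entry_def by (auto split: if_splits)
  obtain k where k: "is_relation R (alternating s t k) (alternating t s k)"
    using nz unfolding coxeter_entry_def by (auto split: if_splits)
  from artin_tits_relation[OF at k] obtain s' t' n' where
    *: "s' \<in> S" "t' \<in> S" "n' \<ge> 2" "alternating s t k = alternating s' t' n'" by blast
  have e: "k = n' \<and> s = s' \<and> t = t'" using alternating_eqD[OF *(4)] *(3) by blast
  then show S: "s \<in> S" "t \<in> S" using *(1,2) by auto
  have "n = k" unfolding n_def by (rule coxeter_entry_eq[OF at S st k])
  then show "n \<ge> 2" "is_relation R (alternating s t n) (alternating t s n)" using k e *(3) by auto
qed

text \<open>The generator of a letter, without its sign.\<close>

fun underlying :: "'a letter \<Rightarrow> 'a" where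
  "underlying (Pos s) = s"
| "underlying (Neg s) = s"

lemma coxeter_matrix_coxeter_entry:
  assumes "artin_tits_presentation S R"
  shows "coxeter_matrix (coxeter_entry R)"
proof
  fix s t
  show "coxeter_entry R s t = coxeter_entry R t s"
    unfolding coxeter_entry_def by (simp add: is_relation_sym[of R "alternating s t _"] eq_commute[of s t])
  show "coxeter_entry R s t \<noteq> 1"
    using coxeter_entry_nonzero(4)[OF assms, of s t] by fastforce
qed

lemma relation_coxeter_entry:
  assumes "artin_tits_presentation S R"
  shows "is_relation R v v' \<longleftrightarrow>
      (\<exists>s t. s \<noteq> t \<and> coxeter_entry R s t \<noteq> 0 \<and> v = map Pos (alt s t (coxeter_entry R s t))
        \<and> v' = map Pos (alt t s (coxeter_entry R s t)))" (is "_ \<longleftrightarrow> ?rhs")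
proof
  assume r: "is_relation R v v'"
  from artin_tits_relation[OF assms r] obtain s t n where
    *: "s \<in> S" "t \<in> S" "n \<ge> 2" "s \<noteq> t" "v = alternating s t n" "v' = alternating t s n" by blast
  have "coxeter_entry R s t = n" using coxeter_entry_eq[OF assms *(1,2,4)] r *(5,6) by simp
  then show ?rhs using * by (intro exI[of _ s] exI[of _ t]) (auto simp: alternating_alt)
next
  assume ?rhs
  then show "is_relation R v v'"
    using coxeter_entry_nonzero(5)[OF assms] by (auto simp: alternating_alt)
qed

text \<open>Equality in the Coxeter group implies equality modulo \<open>\<sim>\<close> after forgetting the signs. This
  direction suffices to transfer finiteness.\<close>

lemma coxeter_group_cox_eq:
  assumes at: "artin_tits_presentation S R"
    and "(u, v) \<in> pres_cong S (R \<union> {([Pos s, Pos s], []) | s. s \<in> S})"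
  shows "coxeter_matrix.cox_eq (coxeter_entry R) (map underlying u) (map underlying v)"
proof -
  interpret coxeter_matrix "coxeter_entry R" by (rule coxeter_matrix_coxeter_entry[OF at])
  have und: "map underlying (map Pos w) = w" for w :: "'a list" by (induction w) auto
  let ?eq = "coxeter_matrix.cox_eq (coxeter_entry R)"
  have sq: "?eq (x @ s # s # y) (x @ y)" for x s y
    using cox_context[OF cox_square[of s y], of x "[]"] by simp
  show ?thesis
    using assms(2)
  proof (induction rule: pres_cong.induct)
    case (rel v v' x y)
    have "?eq (map underlying v) (map underlying v')"
    proof (cases "(v, v') \<in> R")
      case True
      then have "is_relation R v v'" by (simp add: is_relation_def)
      then obtain s t where "s \<noteq> t" "coxeter_entry R s t \<noteq> 0"
        "v = map Pos (alt s t (coxeter_entry R s t))" "v' = map Pos (alt t s (coxeter_entry R s t))"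
        unfolding relation_coxeter_entry[OF at] by blast
      then show ?thesis using braid_imp_cox[OF braid_rel] by (simp only: und)
    next
      case False
      then show ?thesis using rel sq[of "[]" _ "[]"] by auto
    qed
    then show ?case by (simp add: cox_append)
  next
    case (cancel_right s x y)
    then show ?case using sq by simp
  next
    case (cancel_left s x y)
    then show ?case using sq by simp
  next
    case (refl w)
    then show ?case by simp
  next
    case (sym v w)
    show ?case by (rule cox_sym[OF sym.IH])
  next
    case (trans u v w)
    show ?case by (rule cox_trans[OF trans.IH])
  qed
qed

lemma finite_coxeter_classes:
  assumes at: "artin_tits_presentation S R" and "spherical_type S R"
  shows "finite (coxeter_matrix.canon (coxeter_entry R) ` {u. set u \<subseteq> S})"
proof -
  interpret coxeter_matrix "coxeter_entry R" by (rule coxeter_matrix_coxeter_entry[OF at])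
  let ?Q = "R \<union> {([Pos s, Pos s], []) | s. s \<in> S}"
  let ?canon = "coxeter_matrix.canon (coxeter_entry R)"
  let ?f = "\<lambda>X. ?canon (map underlying (SOME w. w \<in> X))"
  have "?canon u \<in> ?f ` carrier (coxeter_group S R)" if u: "set u \<subseteq> S" for u
  proof -
    have w: "map Pos u \<in> words S" using u by (simp add: map_Pos_words)
    let ?X = "word_class S ?Q (map Pos u)"
    have "map Pos u \<in> ?X" using pres_cong.refl[OF w] by (simp add: word_class_def)
    then have "(SOME w. w \<in> ?X) \<in> ?X" by (rule someI)
    then have "(map Pos u, SOME w. w \<in> ?X) \<in> pres_cong S ?Q" by (simp add: word_class_def)
    from coxeter_group_cox_eq[OF at this]
    have "coxeter_matrix.cox_eq (coxeter_entry R) u (map underlying (SOME w. w \<in> ?X))"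
      by (simp add: o_def)
    then have "?canon u = ?f ?X" by (simp only: canon_eq_iff)
    moreover have "?X \<in> carrier (coxeter_group S R)"
      unfolding coxeter_group_def carrier_presented_group using w by blast
    ultimately show ?thesis by blast
  qed
  then have "?canon ` {u. set u \<subseteq> S} \<subseteq> ?f ` carrier (coxeter_group S R)" by blast
  then show ?thesis
    by (rule finite_subset) (rule finite_imageI, use assms(2) in \<open>simp add: spherical_type_def\<close>)
qed

theorem proposition1p11:
  fixes S :: "'a set" and R :: "('a word \<times> 'a word) set"
  assumes "artin_tits_presentation S R"
    and "spherical_type S R"
  shows "property_H S R"
proof -
  interpret coxeter_matrix "coxeter_entry R"
    by (rule coxeter_matrix_coxeter_entry[OF assms(1)])
  interpret artin_tits_spherical "coxeter_entry R" S R
    by unfold_locales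
      (rule finite_coxeter_classes[OF assms] relation_coxeter_entry[OF assms(1)]
        artin_tits_positive[OF assms(1)])+
  show ?thesis by (rule property_H)
qed

end
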